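(* For any incidence function $\varepsilon$ on the toric cell complex $\Delta$, the complex \[ 0\to P_n\xrightarrow{d_n}P_{n-1}\xrightarrow{d_{n-1}}\cdots\xrightarrow{d_2}P_1\xrightarrow{d_1}P_0\xrightarrow{\mu}A\to0 \] is a minimal projective $(A,A)$-bimodule resolution of $A$.
   Context: Let $\mathbb{k}$ be an algebraically closed field and $G\subset\operatorname{SL}(n,\mathbb{k})$ a finite abelian subgroup of diagonal matrices, with $\operatorname{char}\mathbb{k}$ not dividing $|G|$. Let $\rho_i\in G^*=\operatorname{Hom}(G,\mathbb{k}^\times)$ be the $i$-th diagonal entry. The McKay quiver $Q$ has vertex set $G^*$ and, for each $\rho\in G^*$ and $1\le i\le n$, an arrow $a_i^\rho:\rho\to\rho\rho_i$ (label $x_i$). Paths compose right to left. Let $A=\mathbb{k}Q/J$, where $J$ is generated by $a_i^{\rho\rho_j}a_j^\rho-a_j^{\rho\rho_i}a_i^\rho$ for $\rho\in G^*$, $1\le i<j\le n$ (this is isomorphic to the skew group algebra $\mathbb{k}[x_1,\dots,x_n]*G$). Toric cell complex: let $\deg:\mathbb{Z}^n\to G^*$, $\chi_i\mapsto\rho_i$, $M=\ker\deg$, $\mathbb{T}^n=\mathbb{R}^n/M$. The covering quiver has vertex set $\mathbb{Z}^n$ and arrows $u\to u+\chi_i$, mapping to $a_i^{\deg u}$. For $u\in\mathbb{Z}^n$, $S\subseteq\{1,\dots,n\}$ let $F(u,S)=\{u+\sum_{i\in S}\lambda_i\chi_i:0\le\lambda_i\le1\}$ (the faces of unit cubes $u+[0,1]^n$).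 $\Delta$ is the set of images in $\mathbb{T}^n$ of all $F(u,S)$ together with $\emptyset$; it is a finite regular cell complex, $\Delta_k$ being the images with $|S|=k$. For $\eta$ the image of $F(u,S)$: tail $\mathsf{t}(\eta)=\deg u$, head $\mathsf{h}(\eta)=\deg(u+\sum_{i\in S}\chi_i)$ (vertices of $Q$; $\Delta_0$ is identified with $G^*$). For a face $\eta'\subseteq\eta$ take lifts $F(u',S')\subseteq F(u,S)$; the left-derivative $\overleftarrow{\partial}_{\eta'}\eta\in A$ is the class of the image in $Q$ of any path in the covering quiver from $u'+\sum_{S'}\chi_i$ to $u+\sum_S\chi_i$, and the right-derivative $\overrightarrow{\partial}_{\eta'}\eta\in A$ that of any path from $u$ to $u'$ (these are well defined). Facets are faces of codimension one. An incidence function is $\varepsilon:\Delta\times\Delta\to\{0,\pm1\}$ with $\varepsilon(\eta,\eta')=0$ unless $\eta'$ is a facet of $\eta$, $\varepsilon(\eta,\emptyset)=1$ for 0-cells $\eta$, and for $\eta\in\Delta_k$ and a face $\eta''\in\Delta_{k-2}$ of $\eta$, with $\eta'_1,\eta'_2$ the two $(k-1)$-cells that are facets of $\eta$ containing $\eta''$, $\varepsilon(\eta,\eta_1')\varepsilon(\eta_1',\eta'')+\varepsilon(\eta,\eta_2')\varepsilon(\eta_2',\eta'')=0$. The complex: $P_k=\bigoplus_{\eta\in\Delta_k}Ae_{\mathsf{h}(\eta)}\otimes[\eta]\otimes e_{\mathsf{t}(\eta)}A$ (tensor over $\mathbb{k}$, $[\eta]$ a formal symbol; so $P_0=\bigoplus_{i}Ae_i\otimes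 e_iA$), $\mu:P_0\to A$ the multiplication, and $d_k(1\otimes[\eta]\otimes1)=\sum_{\eta'\text{ facet of }\eta}\varepsilon(\eta,\eta')\,\overleftarrow{\partial}_{\eta'}\eta\otimes[\eta']\otimes\overrightarrow{\partial}_{\eta'}\eta$.
   Formalization: Incidence functions are required to be ±1 on every facet (zero would be allowed otherwise), and the sign condition is imposed on lifted cubes, as Δ need not be regular; none exists if some ρ_i is trivial. Projectivity of P_k is left implicit in its form. *)

theory Defs
  imports "HOL-Computational_Algebra.Polynomial"
begin

(* A diagonal matrix in GL(n,k) is represented by its diagonal  i \<mapsto> g i  (i < n),
   normalised by g i = 1 for i \<ge> n. *)
type_synonym 'k diag = "nat \<Rightarrow> 'k"
(* characters G \<rightarrow> k^\<times>, normalised to be 1 outside G *)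
type_synonym 'k chr = "'k diag \<Rightarrow> 'k"
(* a path of Q: (tail vertex, list of arrow labels in order of traversal) *)
type_synonym 'k path = "'k chr \<times> nat list"
(* a cell of the torus R^n/M, represented by its (M-saturated) preimage in R^n *)
type_synonym cell = "(nat \<Rightarrow> real) set"
(* basis element  p \<otimes> [\<eta>] \<otimes> q  of the bimodules P_k (before dividing by J) *)
type_synonym 'k tens = "'k path \<times> cell \<times> 'k path"

definition diag_SL_subgroup :: "nat \<Rightarrow> 'k::field diag set \<Rightarrow> bool" where
  "diag_SL_subgroup n G \<longleftrightarrow> finite G \<and> (\<lambda>_. 1) \<in> G \<and>
     (\<forall>g\<in>G. (\<forall>i\<ge>n. g i = 1) \<and> (\<Prod>i<n. g i) = 1) \<and>
     (\<forall>g\<in>G. \<forall>h\<in>G. (\<lambda>i. g i * h i) \<in> G) \<and>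
     (\<forall>g\<in>G. (\<lambda>i. inverse (g i)) \<in> G)"

definition Gdual :: "'k::field diag set \<Rightarrow> 'k chr set" where
  "Gdual G = {\<chi>. (\<forall>g\<in>G. \<chi> g \<noteq> 0) \<and>
     (\<forall>g\<in>G. \<forall>h\<in>G. \<chi> (\<lambda>i. g i * h i) = \<chi> g * \<chi> h) \<and>
     (\<forall>g. g \<notin> G \<longrightarrow> \<chi> g = 1)}"

definition chmul :: "'k::field chr \<Rightarrow> 'k chr \<Rightarrow> 'k chr" where
  "chmul \<chi> \<psi> = (\<lambda>g. \<chi> g * \<psi> g)"

definition rho :: "'k::field diag set \<Rightarrow> nat \<Rightarrow> 'k chr" where
  "rho G i = (\<lambda>g. if g \<in> G then g i else 1)"

definition Zn :: "nat \<Rightarrow> (nat \<Rightarrow> int) set" where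
  "Zn n = {u. \<forall>i\<ge>n. u i = 0}"

definition degZ :: "nat \<Rightarrow> 'k::field diag set \<Rightarrow> (nat \<Rightarrow> int) \<Rightarrow> 'k chr" where
  "degZ n G u = (\<lambda>g. if g \<in> G then (\<Prod>i<n. (g i) powi (u i)) else 1)"

definition Mlat :: "nat \<Rightarrow> 'k::field diag set \<Rightarrow> (nat \<Rightarrow> int) set" where
  "Mlat n G = {u \<in> Zn n. degZ n G u = degZ n G (\<lambda>_. 0)}"

definition ind :: "nat set \<Rightarrow> nat \<Rightarrow> int" where
  "ind S = (\<lambda>i. if i \<in> S then 1 else 0)"

definition vplus :: "(nat \<Rightarrow> int) \<Rightarrow> (nat \<Rightarrow> int) \<Rightarrow> nat \<Rightarrow> int" where
  "vplus u v = (\<lambda>i. u i + v i)"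

definition cube :: "(nat \<Rightarrow> int) \<Rightarrow> nat set \<Rightarrow> (nat \<Rightarrow> real) set" where
  "cube u S = {x. \<exists>l::nat \<Rightarrow> real. (\<forall>i\<in>S. 0 \<le> l i \<and> l i \<le> 1) \<and>
                 x = (\<lambda>j. of_int (u j) + (if j \<in> S then l j else 0))}"

(* image of F(u,S) in T^n = R^n/M, as an M-saturated subset of R^n *)
definition cellimg :: "nat \<Rightarrow> 'k::field diag set \<Rightarrow> (nat \<Rightarrow> int) \<Rightarrow> nat set \<Rightarrow> cell" where
  "cellimg n G u S = {y. \<exists>x\<in>cube u S. \<exists>m\<in>Mlat n G. y = (\<lambda>j. x j + of_int (m j))}"

definition is_lift :: "nat \<Rightarrow> 'k::field diag set \<Rightarrow> cell \<Rightarrow> (nat \<Rightarrow> int) \<Rightarrow> nat set \<Rightarrow> bool" where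
  "is_lift n G \<eta> u S \<longleftrightarrow> u \<in> Zn n \<and> S \<subseteq> {..<n} \<and> \<eta> = cellimg n G u S"

definition Delta_k :: "nat \<Rightarrow> 'k::field diag set \<Rightarrow> nat \<Rightarrow> cell set" where
  "Delta_k n G k = {\<eta>. \<exists>u S. is_lift n G \<eta> u S \<and> card S = k}"

definition Delta :: "nat \<Rightarrow> 'k::field diag set \<Rightarrow> cell set" where
  "Delta n G = insert {} (\<Union>k. Delta_k n G k)"

definition cell_tail :: "nat \<Rightarrow> 'k::field diag set \<Rightarrow> cell \<Rightarrow> 'k chr" where
  "cell_tail n G \<eta> = (case SOME (u, S). is_lift n G \<eta> u S of (u, S) \<Rightarrow> degZ n G u)"

definition cell_head :: "nat \<Rightarrow> 'k::field diag set \<Rightarrow> cell \<Rightarrow> 'k chr" where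
  "cell_head n G \<eta> = (case SOME (u, S). is_lift n G \<eta> u S of (u, S) \<Rightarrow> degZ n G (vplus u (ind S)))"

definition face_lift :: "nat \<Rightarrow> 'k::field diag set \<Rightarrow> cell \<Rightarrow> cell \<Rightarrow>
    (nat \<Rightarrow> int) \<Rightarrow> nat set \<Rightarrow> (nat \<Rightarrow> int) \<Rightarrow> nat set \<Rightarrow> bool" where
  "face_lift n G \<eta>' \<eta> u' S' u S \<longleftrightarrow>
     is_lift n G \<eta>' u' S' \<and> is_lift n G \<eta> u S \<and> cube u' S' \<subseteq> cube u S"

definition is_facet :: "nat \<Rightarrow> 'k::field diag set \<Rightarrow> cell \<Rightarrow> cell \<Rightarrow> bool" where
  "is_facet n G \<eta>' \<eta> \<longleftrightarrow> (\<eta>' = {} \<and> \<eta> \<in> Delta_k n G 0) \<or>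
     (\<exists>u' S' u S. face_lift n G \<eta>' \<eta> u' S' u S \<and> card S' + 1 = card S)"

definition incidence_fun :: "nat \<Rightarrow> 'k::field diag set \<Rightarrow> (cell \<Rightarrow> cell \<Rightarrow> int) \<Rightarrow> bool" where
  "incidence_fun n G \<epsilon> \<longleftrightarrow>
     (\<forall>\<eta>\<in>Delta n G. \<forall>\<eta>'\<in>Delta n G.
        \<epsilon> \<eta> \<eta>' \<in> {-1, 0, 1} \<and> (\<epsilon> \<eta> \<eta>' \<noteq> 0 \<longleftrightarrow> is_facet n G \<eta>' \<eta>)) \<and>
     (\<forall>\<eta>\<in>Delta_k n G 0. \<epsilon> \<eta> {} = 1) \<and>
     (\<forall>u i. u \<in> Zn n \<longrightarrow> i < n \<longrightarrow>
        (\<Sum>w\<in>{w. w \<in> Zn n \<and> cube w {} \<subseteq> cube u {i}}.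
            \<epsilon> (cellimg n G u {i}) (cellimg n G w {}) * \<epsilon> (cellimg n G w {}) {}) = 0) \<and>
     (\<forall>u S u'' S''. u \<in> Zn n \<longrightarrow> S \<subseteq> {..<n} \<longrightarrow> u'' \<in> Zn n \<longrightarrow> S'' \<subseteq> {..<n} \<longrightarrow>
        card S'' + 2 = card S \<longrightarrow> cube u'' S'' \<subseteq> cube u S \<longrightarrow>
        (\<Sum>(u', S')\<in>{(u', S'). u' \<in> Zn n \<and> S' \<subseteq> {..<n} \<and> card S' + 1 = card S \<and>
                        cube u'' S'' \<subseteq> cube u' S' \<and> cube u' S' \<subseteq> cube u S}.
            \<epsilon> (cellimg n G u S) (cellimg n G u' S') * \<epsilon> (cellimg n G u' S') (cellimg n G u'' S'')) = 0)"

definition path_head :: "'k::field diag set \<Rightarrow> 'k path \<Rightarrow> 'k chr" where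
  "path_head G p = foldl (\<lambda>\<chi> i. chmul \<chi> (rho G i)) (fst p) (snd p)"

definition valid_path :: "nat \<Rightarrow> 'k::field diag set \<Rightarrow> 'k path \<Rightarrow> bool" where
  "valid_path n G p \<longleftrightarrow> fst p \<in> Gdual G \<and> set (snd p) \<subseteq> {..<n}"

(* p \<cdot> q : first q, then p (paths compose right to left) *)
definition pcomp :: "'k path \<Rightarrow> 'k path \<Rightarrow> 'k path" where
  "pcomp p q = (fst q, snd q @ snd p)"

definition pvec :: "'k path \<Rightarrow> 'k path \<Rightarrow> 'k::field" where
  "pvec p = (\<lambda>r. if r = p then 1 else 0)"

definition kQ :: "nat \<Rightarrow> 'k::field diag set \<Rightarrow> ('k path \<Rightarrow> 'k) set" where
  "kQ n G = {a. finite {p. a p \<noteq> 0} \<and> (\<forall>p. a p \<noteq> 0 \<longrightarrow> valid_path n G p)}"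

definition kQmul :: "'k::field diag set \<Rightarrow> ('k path \<Rightarrow> 'k) \<Rightarrow> ('k path \<Rightarrow> 'k) \<Rightarrow> 'k path \<Rightarrow> 'k" where
  "kQmul G a b = (\<lambda>r. \<Sum>(p, q)\<in>{(p, q). a p \<noteq> 0 \<and> b q \<noteq> 0 \<and> fst p = path_head G q \<and> r = pcomp p q}.
                       a p * b q)"

definition comm_rel :: "'k::field chr \<Rightarrow> nat \<Rightarrow> nat \<Rightarrow> 'k path \<Rightarrow> 'k" where
  "comm_rel \<rho> i j = (\<lambda>r. pvec (\<rho>, [j, i]) r - pvec (\<rho>, [i, j]) r)"

inductive_set Jideal :: "nat \<Rightarrow> 'k::field diag set \<Rightarrow> ('k path \<Rightarrow> 'k) set"
  for n :: nat and G :: "'k diag set" where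
  gen: "\<rho> \<in> Gdual G \<Longrightarrow> i < j \<Longrightarrow> j < n \<Longrightarrow> comm_rel \<rho> i j \<in> Jideal n G"
| zero: "(\<lambda>_. 0) \<in> Jideal n G"
| add: "a \<in> Jideal n G \<Longrightarrow> b \<in> Jideal n G \<Longrightarrow> (\<lambda>r. a r + b r) \<in> Jideal n G"
| smul: "a \<in> Jideal n G \<Longrightarrow> (\<lambda>r. c * a r) \<in> Jideal n G"
| lmul: "a \<in> Jideal n G \<Longrightarrow> valid_path n G p \<Longrightarrow> kQmul G (pvec p) a \<in> Jideal n G"
| rmul: "a \<in> Jideal n G \<Longrightarrow> valid_path n G p \<Longrightarrow> kQmul G a (pvec p) \<in> Jideal n G"

(* basis triples of  \<bigoplus>_{\<eta>\<in>\<Delta>_k} kQ e_{h(\<eta>)} \<otimes> [\<eta>] \<otimes> e_{t(\<eta>)} kQ *)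
definition Tk :: "nat \<Rightarrow> 'k::field diag set \<Rightarrow> nat \<Rightarrow> 'k tens set" where
  "Tk n G k = {(p, \<eta>, q). \<eta> \<in> Delta_k n G k \<and> valid_path n G p \<and> valid_path n G q \<and>
                 fst p = cell_head n G \<eta> \<and> path_head G q = cell_tail n G \<eta>}"

definition Pmod :: "nat \<Rightarrow> 'k::field diag set \<Rightarrow> nat \<Rightarrow> ('k tens \<Rightarrow> 'k) set" where
  "Pmod n G k = {x. finite {t. x t \<noteq> 0} \<and> (\<forall>t. x t \<noteq> 0 \<longrightarrow> t \<in> Tk n G k)}"

definition tens :: "('k path \<Rightarrow> 'k) \<Rightarrow> cell \<Rightarrow> ('k path \<Rightarrow> 'k) \<Rightarrow> 'k tens \<Rightarrow> 'k::field" where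
  "tens a \<eta> b = (\<lambda>(p, \<eta>', q). if \<eta>' = \<eta> then a p * b q else 0)"

(* N_k: the kernel of  kQ e_h \<otimes> e_t kQ \<rightarrow> A e_h \<otimes> e_t A, summed over \<Delta>_k;
   P_k = Pmod k / N_k *)
inductive_set Nsub :: "nat \<Rightarrow> 'k::field diag set \<Rightarrow> nat \<Rightarrow> ('k tens \<Rightarrow> 'k) set"
  for n :: nat and G :: "'k diag set" and k :: nat where
  zero: "(\<lambda>_. 0) \<in> Nsub n G k"
| add: "x \<in> Nsub n G k \<Longrightarrow> y \<in> Nsub n G k \<Longrightarrow> (\<lambda>t. x t + y t) \<in> Nsub n G k"
| smul: "x \<in> Nsub n G k \<Longrightarrow> (\<lambda>t. c * x t) \<in> Nsub n G k"
| left: "j \<in> Jideal n G \<Longrightarrow> \<eta> \<in> Delta_k n G k \<Longrightarrow>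
         (\<forall>p. j p \<noteq> 0 \<longrightarrow> fst p = cell_head n G \<eta>) \<Longrightarrow>
         valid_path n G q \<Longrightarrow> path_head G q = cell_tail n G \<eta> \<Longrightarrow>
         tens j \<eta> (pvec q) \<in> Nsub n G k"
| right: "j \<in> Jideal n G \<Longrightarrow> \<eta> \<in> Delta_k n G k \<Longrightarrow>
         (\<forall>q. j q \<noteq> 0 \<longrightarrow> path_head G q = cell_tail n G \<eta>) \<Longrightarrow>
         valid_path n G p \<Longrightarrow> fst p = cell_head n G \<eta> \<Longrightarrow>
         tens (pvec p) \<eta> j \<in> Nsub n G k"

definition labels_of :: "nat \<Rightarrow> (nat \<Rightarrow> int) \<Rightarrow> nat list" where
  "labels_of n v = concat (map (\<lambda>i. replicate (nat (v i)) i) [0..<n])"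

definition face_lifts :: "nat \<Rightarrow> 'k::field diag set \<Rightarrow> cell \<Rightarrow> cell \<Rightarrow>
    (nat \<Rightarrow> int) \<times> nat set \<times> (nat \<Rightarrow> int) \<times> nat set" where
  "face_lifts n G \<eta>' \<eta> = (SOME (u', S', u, S). face_lift n G \<eta>' \<eta> u' S' u S)"

definition lder :: "nat \<Rightarrow> 'k::field diag set \<Rightarrow> cell \<Rightarrow> cell \<Rightarrow> 'k path" where
  "lder n G \<eta>' \<eta> = (case face_lifts n G \<eta>' \<eta> of (u', S', u, S) \<Rightarrow>
     (degZ n G (vplus u' (ind S')), labels_of n (\<lambda>i. (u i + ind S i) - (u' i + ind S' i))))"

definition rder :: "nat \<Rightarrow> 'k::field diag set \<Rightarrow> cell \<Rightarrow> cell \<Rightarrow> 'k path" where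
  "rder n G \<eta>' \<eta> = (case face_lifts n G \<eta>' \<eta> of (u', S', u, S) \<Rightarrow>
     (degZ n G u, labels_of n (\<lambda>i. u' i - u i)))"

definition dbasis :: "nat \<Rightarrow> 'k::field diag set \<Rightarrow> (cell \<Rightarrow> cell \<Rightarrow> int) \<Rightarrow> 'k tens \<Rightarrow> 'k tens \<Rightarrow> 'k" where
  "dbasis n G \<epsilon> t = (case t of (p, \<eta>, q) \<Rightarrow> (\<lambda>s.
     \<Sum>\<eta>'\<in>{\<eta>'. is_facet n G \<eta>' \<eta>}. of_int (\<epsilon> \<eta> \<eta>') *
        tens (kQmul G (pvec p) (pvec (lder n G \<eta>' \<eta>))) \<eta>'
             (kQmul G (pvec (rder n G \<eta>' \<eta>)) (pvec q)) s))"

definition dmap :: "nat \<Rightarrow> 'k::field diag set \<Rightarrow> (cell \<Rightarrow> cell \<Rightarrow> int) \<Rightarrow> ('k tens \<Rightarrow> 'k) \<Rightarrow> 'k tens \<Rightarrow> 'k" where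
  "dmap n G \<epsilon> x = (\<lambda>s. \<Sum>t\<in>{t. x t \<noteq> 0}. x t * dbasis n G \<epsilon> t s)"

definition mu :: "'k::field diag set \<Rightarrow> ('k tens \<Rightarrow> 'k) \<Rightarrow> 'k path \<Rightarrow> 'k" where
  "mu G x = (\<lambda>r. \<Sum>t\<in>{t. x t \<noteq> 0}. (case t of (p, \<eta>, q) \<Rightarrow> x t * kQmul G (pvec p) (pvec q) r))"

(* 0 \<rightarrow> P_n \<rightarrow> ... \<rightarrow> P_0 \<rightarrow> A \<rightarrow> 0 is a well-defined complex of (A,A)-bimodule maps,
   exact, and minimal (im d_k \<subseteq> rad P_{k-1}). All statements are on the kQ level, modulo J/N. *)
definition min_proj_bimod_resolution ::
    "nat \<Rightarrow> 'k::field diag set \<Rightarrow> (cell \<Rightarrow> cell \<Rightarrow> int) \<Rightarrow> bool" where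
  "min_proj_bimod_resolution n G \<epsilon> \<longleftrightarrow>
     \<comment> \<open>maps land in the right modules\<close>
     (\<forall>k\<ge>1. \<forall>x\<in>Pmod n G k. dmap n G \<epsilon> x \<in> Pmod n G (k - 1)) \<and>
     (\<forall>x\<in>Pmod n G 0. mu G x \<in> kQ n G) \<and>
     \<comment> \<open>maps are well defined on the quotients by J\<close>
     (\<forall>k\<ge>1. \<forall>x\<in>Nsub n G k. dmap n G \<epsilon> x \<in> Nsub n G (k - 1)) \<and>
     (\<forall>x\<in>Nsub n G 0. mu G x \<in> Jideal n G) \<and>
     \<comment> \<open>complex\<close>
     (\<forall>k\<ge>2. \<forall>x\<in>Pmod n G k. dmap n G \<epsilon> (dmap n G \<epsilon> x) \<in> Nsub n G (k - 2)) \<and>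
     (\<forall>x\<in>Pmod n G 1. mu G (dmap n G \<epsilon> x) \<in> Jideal n G) \<and>
     \<comment> \<open>exactness at A, P_0, and P_k (k \<ge> 1; at P_n this is injectivity of d_n)\<close>
     (\<forall>a\<in>kQ n G. \<exists>x\<in>Pmod n G 0. (\<lambda>r. mu G x r - a r) \<in> Jideal n G) \<and>
     (\<forall>x\<in>Pmod n G 0. mu G x \<in> Jideal n G \<longrightarrow>
        (\<exists>y\<in>Pmod n G 1. (\<lambda>t. x t - dmap n G \<epsilon> y t) \<in> Nsub n G 0)) \<and>
     (\<forall>k\<ge>1. \<forall>x\<in>Pmod n G k. dmap n G \<epsilon> x \<in> Nsub n G (k - 1) \<longrightarrow>
        (\<exists>y\<in>Pmod n G (k + 1). (\<lambda>t. x t - dmap n G \<epsilon> y t) \<in> Nsub n G k)) \<and>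
     \<comment> \<open>minimality: d_k(P_k) \<subseteq> rad P_{k-1} = R P_{k-1} + P_{k-1} R, R the arrow ideal\<close>
     (\<forall>k\<ge>1. \<forall>x\<in>Pmod n G k. \<exists>y\<in>Pmod n G (k - 1).
        (\<forall>p \<eta> q. y (p, \<eta>, q) \<noteq> 0 \<longrightarrow> snd p \<noteq> [] \<or> snd q \<noteq> []) \<and>
        (\<lambda>t. dmap n G \<epsilon> x t - y t) \<in> Nsub n G (k - 1))"

end

theory Submission
  imports Defs "HOL-Library.Multiset"
begin

text \<open>
  Modulo the commutation relations a path is determined by its tail and the multiset of its labels,
  so \<open>P\<^sub>k\<close> has a basis of tuples \<open>(\<omega>, S, A, B)\<close>: \<open>B\<close> is the monomial of the right factor, which starts
  at \<open>\<omega>\<close>, \<open>S\<close> is the direction set of the cell and \<open>A\<close> is the monomial of the left factor.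
  The differential preserves \<open>\<omega>\<close> and the total monomial \<open>A + S + B\<close>; the summand of the complex
  with these fixed is the augmented cellular chain complex of a box with faces \<open>B + [0,1]\<^sup>S\<close>.
  An acyclic matching of the faces of the box shows exactness. The argument needs only that all
  incidences are \<open>\<plusminus>1\<close> and that \<open>d \<circ> d = 0\<close>, so no normalisation of the incidence function is required.
\<close>

section \<open>Finitely supported functions\<close>

text \<open>\<open>Jideal\<close> and \<open>Nsub\<close> are generated inductively, so
  non-membership is not visible from their definitions. Pushing forward along the class map turns
  membership into the vanishing of a vector: generators die there, and conversely every path is
  congruent to the one with sorted labels (\<open>Jideal_iff\<close>, \<open>Nsub_iff\<close>).
  Every clause of the goal thus becomes a statement about \<open>class_bd\<close> and
  \<open>class_mu\<close>. Cells are point sets whose lifts are picked by \<open>SOME\<close>; they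
  are renamed by tail and direction set. This requires that every vertex of Q is the degree of a
  lattice point, and that a facet determines on which side of its cell it lies, as otherwise the
  derivatives would depend on the chosen lift. The matching is used in two halves. Modulo boundaries
  a chain can be cleared of the classes in \<open>upward\<close>, by elimination; on chains free of
  them the boundary (in degree zero the augmentation) is injective, by triangularity. A cleared
  cycle is therefore zero, so the original cycle was a boundary.\<close>

definition fsupp :: "'a set \<Rightarrow> ('a \<Rightarrow> 'k::zero) set" where
  "fsupp A = {x. finite {t. x t \<noteq> 0} \<and> {t. x t \<noteq> 0} \<subseteq> A}"

definition delta :: "'a \<Rightarrow> 'a \<Rightarrow> 'k::zero_neq_one" where
  "delta c = (\<lambda>t. if t = c then 1 else 0)"

text \<open>Linear extension of \<open>f\<close> from basis vectors; with
  \<open>f t = delta (c t)\<close> it is the pushforward along \<open>c\<close>. A sum over an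
  infinite set is 0 by convention, so linearity needs the \<open>fsupp\<close> hypotheses
  below.\<close>

definition lin :: "('a \<Rightarrow> 'b \<Rightarrow> 'k) \<Rightarrow> ('a \<Rightarrow> 'k) \<Rightarrow> 'b \<Rightarrow> 'k::comm_ring_1" where
  "lin f x = (\<lambda>s. \<Sum>t\<in>{t. x t \<noteq> 0}. x t * f t s)"

lemma fsupp_mono: "x \<in> fsupp A \<Longrightarrow> A \<subseteq> B \<Longrightarrow> x \<in> fsupp B"
  by (auto simp: fsupp_def)

lemma fsupp_UNIV: "x \<in> fsupp A \<Longrightarrow> x \<in> fsupp UNIV"
  by (auto simp: fsupp_def)

lemma fsupp_finite: "x \<in> fsupp A \<Longrightarrow> finite {t. x t \<noteq> 0}"
  by (simp add: fsupp_def)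

lemma fsupp_mem: "x \<in> fsupp A \<Longrightarrow> x t \<noteq> 0 \<Longrightarrow> t \<in> A"
  by (auto simp: fsupp_def)

lemma fsuppI: "finite F \<Longrightarrow> (\<And>t. x t \<noteq> 0 \<Longrightarrow> t \<in> F \<and> t \<in> A) \<Longrightarrow> x \<in> fsupp A"
  by (auto simp: fsupp_def intro: finite_subset[of _ F])

lemma fsupp_zero: "(\<lambda>_. 0) \<in> fsupp A"
  by (simp add: fsupp_def)

lemma fsupp_add:
  fixes x y :: "'a \<Rightarrow> 'k::comm_ring_1"
  assumes "x \<in> fsupp A" "y \<in> fsupp A" shows "(\<lambda>t. x t + y t) \<in> fsupp A"
  by (rule fsuppI[of "{t. x t \<noteq> 0} \<union> {t. y t \<noteq> 0}"]) (use assms in \<open>force simp: fsupp_def\<close>)+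

lemma fsupp_smul:
  fixes x :: "'a \<Rightarrow> 'k::comm_ring_1"
  assumes "x \<in> fsupp A" shows "(\<lambda>t. c * x t) \<in> fsupp A"
  by (rule fsuppI[of "{t. x t \<noteq> 0}"]) (use assms in \<open>force simp: fsupp_def\<close>)+

lemma fsupp_diff:
  fixes x y :: "'a \<Rightarrow> 'k::comm_ring_1"
  assumes "x \<in> fsupp A" "y \<in> fsupp A" shows "(\<lambda>t. x t - y t) \<in> fsupp A"
  using fsupp_add[OF assms(1) fsupp_smul[OF assms(2), of "-1"]] by simp

lemma fsupp_sum:
  fixes f :: "'i \<Rightarrow> 'a \<Rightarrow> 'k::comm_ring_1"
  shows "(\<And>i. i \<in> I \<Longrightarrow> f i \<in> fsupp A) \<Longrightarrow> (\<lambda>t. \<Sum>i\<in>I. f i t) \<in> fsupp A"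
  by (induction I rule: infinite_finite_induct) (auto intro: fsupp_zero fsupp_add)

lemma fsupp_delta: "c \<in> A \<Longrightarrow> delta c \<in> fsupp A"
  by (rule fsuppI[of "{c}"]) (auto simp: delta_def split: if_splits)

lemma lin_eq_sum:
  assumes "finite F" "\<And>t. x t \<noteq> 0 \<Longrightarrow> t \<in> F"
  shows "lin f x s = (\<Sum>t\<in>F. x t * f t s)"
  unfolding lin_def by (rule sum.mono_neutral_left) (use assms in auto)

lemma lin_zero: "lin f (\<lambda>_. 0) = (\<lambda>_. 0)"
  by (simp add: lin_def)

lemma lin_add:
  assumes "x \<in> fsupp UNIV" "y \<in> fsupp UNIV"
  shows "lin f (\<lambda>t. x t + y t) = (\<lambda>s. lin f x s + lin f y s)"
proof
  fix s
  let ?F = "{t. x t \<noteq> 0} \<union> {t. y t \<noteq> 0}"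
  have F: "finite ?F" using assms by (auto simp: fsupp_def)
  have "lin f (\<lambda>t. x t + y t) s = (\<Sum>t\<in>?F. (x t + y t) * f t s)"
    by (rule lin_eq_sum) (use F in auto)
  also have "\<dots> = (\<Sum>t\<in>?F. x t * f t s) + (\<Sum>t\<in>?F. y t * f t s)"
    by (simp add: distrib_right sum.distrib)
  also have "\<dots> = lin f x s + lin f y s"
    by (subst (1 2) lin_eq_sum[OF F]) auto
  finally show "lin f (\<lambda>t. x t + y t) s = lin f x s + lin f y s" .
qed

lemma lin_smul:
  assumes "x \<in> fsupp UNIV"
  shows "lin f (\<lambda>t. c * x t) = (\<lambda>s. c * lin f x s)"
proof
  fix s
  have "lin f (\<lambda>t. c * x t) s = (\<Sum>t\<in>{t. x t \<noteq> 0}. c * x t * f t s)"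
    by (rule lin_eq_sum) (use assms in \<open>auto simp: fsupp_def\<close>)
  then show "lin f (\<lambda>t. c * x t) s = c * lin f x s"
    by (simp add: lin_def sum_distrib_left mult.assoc)
qed

lemma lin_diff:
  assumes "x \<in> fsupp UNIV" "y \<in> fsupp UNIV"
  shows "lin f (\<lambda>t. x t - y t) = (\<lambda>s. lin f x s - lin f y s)"
  using lin_add[OF assms(1) fsupp_smul[OF assms(2), of "-1"], of f] lin_smul[OF assms(2), of f "-1"]
  by simp

lemma lin_sum:
  assumes "\<And>i. i \<in> I \<Longrightarrow> g i \<in> fsupp UNIV"
  shows "lin f (\<lambda>t. \<Sum>i\<in>I. g i t) = (\<lambda>s. \<Sum>i\<in>I. lin f (g i) s)"
  using assms
  by (induction I rule: infinite_finite_induct) (auto simp: lin_zero lin_add fsupp_sum)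

lemma lin_delta: "lin f (delta c) = f c"
proof
  fix s
  have "lin f (delta c) s = (\<Sum>t\<in>{c}. delta c t * f t s)"
    by (rule lin_eq_sum) (auto simp: delta_def split: if_splits)
  then show "lin f (delta c) s = f c s" by (simp add: delta_def)
qed

lemma lin_cong: "x \<in> fsupp A \<Longrightarrow> (\<And>t. t \<in> A \<Longrightarrow> f t = g t) \<Longrightarrow> lin f x = lin g x"
  unfolding lin_def fun_eq_iff by (auto intro!: sum.cong dest: fsupp_mem)

lemma lin_fsupp:
  assumes "x \<in> fsupp A" "\<And>t. t \<in> A \<Longrightarrow> f t \<in> fsupp B"
  shows "lin f x \<in> fsupp B"
  unfolding lin_def by (rule fsupp_sum) (use assms in \<open>auto intro!: fsupp_smul dest: fsupp_mem\<close>)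

lemma lin_lin:
  assumes "x \<in> fsupp A" "\<And>t. t \<in> A \<Longrightarrow> f t \<in> fsupp UNIV"
  shows "lin g (lin f x) = lin (\<lambda>t. lin g (f t)) x"
proof -
  have "lin g (lin f x) = (\<lambda>s. \<Sum>t\<in>{t. x t \<noteq> 0}. lin g (\<lambda>s. x t * f t s) s)"
    unfolding lin_def[of f x]
    by (rule lin_sum) (use assms in \<open>auto intro!: fsupp_smul dest: fsupp_mem\<close>)
  also have "\<dots> = lin (\<lambda>t. lin g (f t)) x"
    unfolding lin_def[of _ x]
    by (auto intro!: sum.cong simp: fun_eq_iff lin_smul dest!: fsupp_mem[OF assms(1)] simp: assms(2))
  finally show ?thesis .
qed

text \<open>The device that descends maps to classes: a linear map whose values on basis vectors
  depend only on their class kills everything whose pushforward is zero.\<close>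

lemma lin_class_factor:
  assumes "x \<in> fsupp A" "\<And>t. t \<in> A \<Longrightarrow> f t = g (c t)"
  shows "lin f x = lin g (lin (\<lambda>t. delta (c t)) x)"
  by (subst lin_lin[OF assms(1)]) (auto simp: lin_delta fsupp_delta intro: lin_cong[OF assms])

lemma lin_delta_id: "x \<in> fsupp A \<Longrightarrow> lin delta x = x"
proof
  fix s assume x: "x \<in> fsupp A"
  have "lin delta x s = (\<Sum>t\<in>insert s {t. x t \<noteq> 0}. x t * delta t s)"
    by (rule lin_eq_sum) (use x in \<open>auto simp: fsupp_def\<close>)
  also have "\<dots> = (\<Sum>t\<in>{s}. x t * delta t s)"
    by (rule sum.mono_neutral_right) (use x in \<open>auto simp: fsupp_def delta_def\<close>)
  finally show "lin delta x s = x s" by (simp add: delta_def)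
qed

lemma fsupp_induct [consumes 1, case_names zero add]:
  assumes "x \<in> fsupp A" "P (\<lambda>_. 0)"
    and "\<And>y c a. y \<in> fsupp A \<Longrightarrow> P y \<Longrightarrow> c \<in> A \<Longrightarrow> P (\<lambda>t. y t + a * delta c t)"
  shows "P (x :: 'a \<Rightarrow> 'k::comm_ring_1)"
proof -
  have "P (\<lambda>s. \<Sum>t\<in>F. x t * delta t s) \<and> (\<lambda>s. \<Sum>t\<in>F. x t * delta t s) \<in> fsupp A"
    if "finite F" "F \<subseteq> A" for F
    using that
  proof (induction F)
    case empty
    then show ?case using assms(2) by (simp add: fsupp_zero)
  next
    case (insert c F)
    then show ?case
      using assms(3)[of "\<lambda>s. \<Sum>t\<in>F. x t * delta t s" c "x c"]
        fsupp_add[OF _ fsupp_smul[OF fsupp_delta, of c], of "\<lambda>s. \<Sum>t\<in>F. x t * delta t s" A "x c"]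
      by (simp add: add.commute)
  qed
  from this[of "{t. x t \<noteq> 0}"] show ?thesis
    using assms(1) lin_delta_id[OF assms(1)] by (simp add: fsupp_def lin_def)
qed

text \<open>Gaussian elimination along a matching: every basis vector in \<open>U\<close> is the leading term of a boundary.\<close>

lemma reduce_mod_image:
  fixes D :: "'b \<Rightarrow> 'a \<Rightarrow> 'k::comm_ring_1" and sz :: "'a \<Rightarrow> nat"
  assumes lead: "\<And>c. c \<in> V \<Longrightarrow> c \<in> U \<Longrightarrow>
      \<exists>y\<in>fsupp V'. (\<lambda>t. delta c t - lin D y t) \<in> fsupp {c'\<in>V. c' \<notin> U \<or> sz c' < sz c}"
    and x: "x \<in> fsupp V"
  shows "\<exists>y\<in>fsupp V'. (\<lambda>t. x t - lin D y t) \<in> fsupp (V - U)"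
proof -
  define R where "R = {x. \<exists>y\<in>fsupp V'. (\<lambda>t. x t - lin D y t) \<in> fsupp (V - U)}"
  have R0: "(\<lambda>_. 0) \<in> R"
    unfolding R_def by (auto intro!: bexI[of _ "\<lambda>_. 0"] simp: lin_zero fsupp_zero)
  have Radd: "(\<lambda>t. x t + a * z t) \<in> R" if xz: "x \<in> R" "z \<in> R" for x z a
  proof -
    obtain y y' where y: "y \<in> fsupp V'" "(\<lambda>t. x t - lin D y t) \<in> fsupp (V - U)"
      "y' \<in> fsupp V'" "(\<lambda>t. z t - lin D y' t) \<in> fsupp (V - U)"
      using xz unfolding R_def by blast
    have "(\<lambda>t. (x t - lin D y t) + a * (z t - lin D y' t)) \<in> fsupp (V - U)"
      by (intro fsupp_add fsupp_smul y)
    moreover have "lin D (\<lambda>t. y t + a * y' t) = (\<lambda>t. lin D y t + a * lin D y' t)"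
      using y by (subst lin_add) (auto intro!: fsupp_smul intro: fsupp_UNIV simp: lin_smul[OF fsupp_UNIV])
    ultimately have "(\<lambda>t. (x t + a * z t) - lin D (\<lambda>t. y t + a * y' t) t) \<in> fsupp (V - U)"
      by (simp add: algebra_simps)
    then show ?thesis unfolding R_def using fsupp_add[OF y(1) fsupp_smul[OF y(3)]] by blast
  qed
  have Rspan: "x \<in> R" if "x \<in> fsupp A" "\<And>c. c \<in> A \<Longrightarrow> delta c \<in> R" for x A
    using that by (induction rule: fsupp_induct) (auto intro: R0 Radd)
  have "delta c \<in> R" if "c \<in> V" for c
    using that
  proof (induction "sz c" arbitrary: c rule: less_induct)
    case less
    have notU: "delta c' \<in> R" if "c' \<in> V" "c' \<notin> U" for c'
      unfolding R_def using that by (auto intro!: bexI[of _ "\<lambda>_. 0"] simp: lin_zero fsupp_zero fsupp_delta)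
    show ?case
    proof (cases "c \<in> U")
      case False
      then show ?thesis using less notU by blast
    next
      case True
      from lead[OF less.prems True] obtain y where y: "y \<in> fsupp V'"
        "(\<lambda>t. delta c t - lin D y t) \<in> fsupp {c'\<in>V. c' \<notin> U \<or> sz c' < sz c}" by blast
      \<comment> \<open>The remainder involves only vectors outside \<open>U\<close>, or of smaller
        \<open>sz\<close>, where the induction hypothesis applies; \<open>lin D y\<close> itself
        reduces to zero.\<close>
      have "(\<lambda>t. delta c t - lin D y t) \<in> R"
        by (rule Rspan[OF y(2)]) (use less notU in blast)
      moreover have "lin D y \<in> R"
        unfolding R_def using y(1) by (auto intro!: bexI[of _ y] simp: fsupp_zero)
      ultimately show ?thesis using Radd[of "\<lambda>t. delta c t - lin D y t" "lin D y" 1] by simp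
    qed
  qed
  then have "x \<in> R" using Rspan[OF x] by blast
  then show ?thesis by (simp add: R_def)
qed

text \<open>Triangularity. For \<open>c\<close> of maximal \<open>sz\<close> in the support of
  \<open>x\<close>, no other member of the support contributes to the coefficient at
  \<open>\<psi> c\<close>, so that coefficient is a product of two nonzero factors.\<close>

lemma lin_injective_on_leading:
  fixes D :: "'a \<Rightarrow> 'b \<Rightarrow> 'k::idom" and sz :: "'a \<Rightarrow> nat"
  assumes x: "x \<in> fsupp W" and zero: "lin D x = (\<lambda>_. 0)"
    and lead: "\<And>c. c \<in> W \<Longrightarrow> D c (\<psi> c) \<noteq> 0"
    and others: "\<And>c c'. c \<in> W \<Longrightarrow> c' \<in> W \<Longrightarrow> D c' (\<psi> c) \<noteq> 0 \<Longrightarrow> c' = c \<or> sz c < sz c'"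
  shows "x = (\<lambda>_. 0)"
proof (rule ccontr)
  assume "x \<noteq> (\<lambda>_. 0)"
  then have "{t. x t \<noteq> 0} \<noteq> {}" by auto
  then have "Max (sz ` {t. x t \<noteq> 0}) \<in> sz ` {t. x t \<noteq> 0}"
    by (intro Max_in) (auto simp: fsupp_finite[OF x])
  then obtain c where c: "x c \<noteq> 0" and "sz c = Max (sz ` {t. x t \<noteq> 0})" by auto
  then have max: "sz c' \<le> sz c" if "x c' \<noteq> 0" for c'
    using that by (simp add: fsupp_finite[OF x])
  have W: "c \<in> W" using fsupp_mem[OF x c] .
  have "lin D x (\<psi> c) = (\<Sum>t\<in>{c}. x t * D t (\<psi> c))"
    unfolding lin_def
    by (rule sum.mono_neutral_right)
      (use c fsupp_finite[OF x] others[OF W] max in \<open>force dest: fsupp_mem[OF x]\<close>)+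
  then show False using zero c lead[OF W] by simp
qed

text \<open>Each ordered pair is cancelled against its transpose. Showing only that twice the sum
  vanishes would not suffice in characteristic 2.\<close>

lemma sum_antisym_zero:
  fixes f :: "'a \<Rightarrow> 'a \<Rightarrow> 'b::comm_monoid_add"
  assumes "finite S" "\<And>i j. i \<in> S \<Longrightarrow> j \<in> S \<Longrightarrow> i \<noteq> j \<Longrightarrow> f i j + f j i = 0"
  shows "(\<Sum>i\<in>S. \<Sum>j\<in>S - {i}. f i j) = 0"
  using assms
proof (induction S)
  case empty
  then show ?case by simp
next
  case (insert a S)
  have "(\<Sum>i\<in>S. \<Sum>j\<in>insert a S - {i}. f i j) = (\<Sum>i\<in>S. f i a + (\<Sum>j\<in>S - {i}. f i j))"
  proof (rule sum.cong[OF refl])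
    fix i assume "i \<in> S"
    then have "insert a S - {i} = insert a (S - {i})" using insert by auto
    then show "(\<Sum>j\<in>insert a S - {i}. f i j) = f i a + (\<Sum>j\<in>S - {i}. f i j)"
      using insert by simp
  qed
  also have "\<dots> = (\<Sum>i\<in>S. f i a)"
    using insert by (simp add: sum.distrib)
  finally have "(\<Sum>i\<in>insert a S. \<Sum>j\<in>insert a S - {i}. f i j) = (\<Sum>j\<in>S. f a j) + (\<Sum>i\<in>S. f i a)"
    using insert by simp
  also have "\<dots> = (\<Sum>j\<in>S. f a j + f j a)" by (simp add: sum.distrib)
  also have "\<dots> = 0" using insert by (intro sum.neutral) auto
  finally show ?case .
qed

section \<open>The path algebra modulo commutation\<close>

lemma pvec_eq_delta: "pvec = delta"
  by (simp add: pvec_def delta_def fun_eq_iff)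

lemma kQ_eq_fsupp: "kQ n G = fsupp {p. valid_path n G p}"
  by (auto simp: kQ_def fsupp_def)

lemma Pmod_eq_fsupp: "Pmod n G k = fsupp (Tk n G k)"
  by (auto simp: Pmod_def fsupp_def)

lemma dmap_eq_lin: "dmap n G \<epsilon> = lin (dbasis n G \<epsilon>)"
  by (simp add: dmap_def lin_def fun_eq_iff)

lemma mu_eq_lin: "mu G = lin (\<lambda>(p, \<eta>, q). kQmul G (delta p) (delta q))"
  by (auto simp: mu_def lin_def fun_eq_iff pvec_eq_delta intro!: sum.cong)

lemma kQmul_delta_left:
  assumes "a \<in> fsupp UNIV"
  shows "kQmul G (delta p) a =
    lin (\<lambda>q. if fst p = path_head G q then delta (pcomp p q) else (\<lambda>_. 0)) a"
proof
  fix r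
  have *: "{(p', q). (delta p p' :: 'a) \<noteq> 0 \<and> a q \<noteq> 0 \<and> fst p' = path_head G q \<and> r = pcomp p' q} =
    Pair p ` {q \<in> {q. a q \<noteq> 0}. fst p = path_head G q \<and> r = pcomp p q}"
    by (auto simp: delta_def split: if_splits)
  have "kQmul G (delta p) a r = (\<Sum>q\<in>{q \<in> {q. a q \<noteq> 0}. fst p = path_head G q \<and> r = pcomp p q}. a q)"
    unfolding kQmul_def * by (subst sum.reindex) (auto simp: inj_on_def delta_def)
  also have "\<dots> = lin (\<lambda>q. if fst p = path_head G q then delta (pcomp p q) else (\<lambda>_. 0)) a r"
    unfolding lin_def sum.inter_filter[OF fsupp_finite[OF assms]]
    by (rule sum.cong) (auto simp: delta_def)
  finally show "kQmul G (delta p) a r =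
    lin (\<lambda>q. if fst p = path_head G q then delta (pcomp p q) else (\<lambda>_. 0)) a r" .
qed

lemma kQmul_delta_right:
  assumes "a \<in> fsupp UNIV"
  shows "kQmul G a (delta q) =
    lin (\<lambda>p. if fst p = path_head G q then delta (pcomp p q) else (\<lambda>_. 0)) a"
proof
  fix r
  have *: "{(p, q'). a p \<noteq> 0 \<and> (delta q q' :: 'a) \<noteq> 0 \<and> fst p = path_head G q' \<and> r = pcomp p q'} =
    (\<lambda>p. (p, q)) ` {p \<in> {p. a p \<noteq> 0}. fst p = path_head G q \<and> r = pcomp p q}"
    by (auto simp: delta_def split: if_splits)
  have "kQmul G a (delta q) r = (\<Sum>p\<in>{p \<in> {p. a p \<noteq> 0}. fst p = path_head G q \<and> r = pcomp p q}. a p)"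
    unfolding kQmul_def * by (subst sum.reindex) (auto simp: inj_on_def delta_def)
  also have "\<dots> = lin (\<lambda>p. if fst p = path_head G q then delta (pcomp p q) else (\<lambda>_. 0)) a r"
    unfolding lin_def sum.inter_filter[OF fsupp_finite[OF assms]]
    by (rule sum.cong) (auto simp: delta_def)
  finally show "kQmul G a (delta q) r =
    lin (\<lambda>p. if fst p = path_head G q then delta (pcomp p q) else (\<lambda>_. 0)) a r" .
qed

lemma kQmul_delta_delta:
  "kQmul G (delta p) (delta q) = (if fst p = path_head G q then delta (pcomp p q) else (\<lambda>_. 0))"
  by (subst kQmul_delta_left) (auto simp: fsupp_delta lin_delta)

text \<open>The vertex reached from a given one along arrows with labels \<open>A\<close>; a
  multiset suffices because characters commute, so the head of a path depends only on its
  class.\<close>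

definition chr_shift :: "'k::field diag set \<Rightarrow> 'k chr \<Rightarrow> nat multiset \<Rightarrow> 'k chr" where
  "chr_shift G \<chi> A = (\<lambda>g. \<chi> g * (\<Prod>i\<in>#A. rho G i g))"

lemma path_head_eq: "path_head G (\<chi>, l) = chr_shift G \<chi> (mset l)"
proof (induction l arbitrary: \<chi>)
  case Nil
  then show ?case by (simp add: path_head_def chr_shift_def)
next
  case (Cons i l)
  have "path_head G (\<chi>, i # l) = path_head G (chmul \<chi> (rho G i), l)"
    by (simp add: path_head_def)
  then show ?case by (simp add: Cons chr_shift_def chmul_def mult.assoc)
qed

lemma chr_shift_union: "chr_shift G (chr_shift G \<chi> A) B = chr_shift G \<chi> (A + B)"
  by (simp add: chr_shift_def mult.assoc)

lemma chr_shift_empty [simp]: "chr_shift G \<chi> {#} = \<chi>"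
  by (simp add: chr_shift_def)

definition path_class :: "'k path \<Rightarrow> 'k chr \<times> nat multiset" where
  "path_class p = (fst p, mset (snd p))"

lemma path_head_class: "path_head G p = chr_shift G (fst (path_class p)) (snd (path_class p))"
  by (cases p) (simp add: path_class_def path_head_eq)

definition sorted_path :: "'k chr \<times> nat multiset \<Rightarrow> 'k path" where
  "sorted_path c = (fst c, sorted_list_of_multiset (snd c))"

locale diag_group =
  fixes n :: nat and G :: "'k::field diag set"
  assumes grp: "diag_SL_subgroup n G"
begin

lemma G_finite: "finite G" and G_one: "(\<lambda>_. 1) \<in> G"
  and G_mult: "g \<in> G \<Longrightarrow> h \<in> G \<Longrightarrow> (\<lambda>i. g i * h i) \<in> G"
  and G_inv: "g \<in> G \<Longrightarrow> (\<lambda>i. inverse (g i)) \<in> G"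
  and G_outside: "g \<in> G \<Longrightarrow> i \<ge> n \<Longrightarrow> g i = 1"
  using grp by (auto simp: diag_SL_subgroup_def)

text \<open>The determinant condition excludes zero entries; closure under \<open>inverse\<close>
  would not, since \<open>inverse 0 = 0\<close>.\<close>

lemma G_nonzero: "g \<in> G \<Longrightarrow> g i \<noteq> 0"
proof (cases "i < n")
  case True
  assume "g \<in> G"
  then have "(\<Prod>i<n. g i) = 1" using grp by (auto simp: diag_SL_subgroup_def)
  then show ?thesis using True by (metis finite_lessThan lessThan_iff prod_zero_iff zero_neq_one)
qed (use G_outside in force)

lemma rho_Gdual: "rho G i \<in> Gdual G"
  by (auto simp: rho_def Gdual_def G_nonzero G_mult)

lemma chr_shift_Gdual: "\<chi> \<in> Gdual G \<Longrightarrow> chr_shift G \<chi> A \<in> Gdual G"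
proof (induction A)
  case (add i A)
  have *: "chr_shift G \<chi> (add_mset i A) = (\<lambda>g. chr_shift G \<chi> A g * rho G i g)"
    by (simp add: chr_shift_def mult_ac)
  show ?case
    using add rho_Gdual[of i] unfolding * by (auto simp: Gdual_def mult_ac)
qed simp

lemma path_head_Gdual: "valid_path n G p \<Longrightarrow> path_head G p \<in> Gdual G"
  by (auto simp: path_head_class valid_path_def path_class_def intro: chr_shift_Gdual)

lemma Jideal_kQ: "a \<in> Jideal n G \<Longrightarrow> a \<in> kQ n G"
  unfolding kQ_eq_fsupp
proof (induction rule: Jideal.induct)
  case (gen \<rho> i j)
  then show ?case
    by (auto simp: comm_rel_def pvec_eq_delta valid_path_def intro!: fsupp_diff fsupp_delta)
next
  case (lmul a p)
  then show ?case unfolding pvec_eq_delta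
    by (subst kQmul_delta_left)
      (auto intro: fsupp_UNIV fsupp_zero intro!: lin_fsupp fsupp_delta simp: valid_path_def pcomp_def)
next
  case (rmul a p)
  then show ?case unfolding pvec_eq_delta
    by (subst kQmul_delta_right)
      (auto intro: fsupp_UNIV fsupp_zero intro!: lin_fsupp fsupp_delta simp: valid_path_def pcomp_def)
qed (auto intro: fsupp_zero fsupp_add fsupp_smul)

text \<open>Both sides of a commutation relation have the same class. Multiplication by a path
  respects this, because composability and the class of the product depend only on the classes of
  the factors.\<close>

lemma Jideal_class_zero:
  "a \<in> Jideal n G \<Longrightarrow> lin (\<lambda>p. delta (path_class p)) a = (\<lambda>_. 0 :: 'k)"
proof (induction rule: Jideal.induct)
  case (gen \<rho> i j)
  then show ?case
    by (simp add: comm_rel_def pvec_eq_delta lin_diff fsupp_delta lin_delta path_class_def add_mset_commute)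
next
  case zero
  then show ?case by (simp add: lin_zero)
next
  case (add a b)
  then show ?case by (subst lin_add) (auto dest!: Jideal_kQ simp: kQ_eq_fsupp intro: fsupp_UNIV)
next
  case (smul a c)
  then show ?case by (subst lin_smul) (auto dest!: Jideal_kQ simp: kQ_eq_fsupp intro: fsupp_UNIV)
next
  case (lmul a p)
  have a: "a \<in> fsupp UNIV" using Jideal_kQ[OF lmul(1)] by (auto simp: kQ_eq_fsupp intro: fsupp_UNIV)
  let ?f = "\<lambda>q. if fst p = path_head G q then delta (pcomp p q) else (\<lambda>_. 0 :: 'k)"
  let ?g = "\<lambda>c. if fst p = chr_shift G (fst c) (snd c) then delta (fst c, snd c + mset (snd p)) else (\<lambda>_. 0 :: 'k)"
  have "lin (\<lambda>p. delta (path_class p)) (kQmul G (pvec p) a)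
      = lin (\<lambda>t. lin (\<lambda>p. delta (path_class p)) (?f t)) a"
    unfolding pvec_eq_delta kQmul_delta_left[OF a]
    by (rule lin_lin[OF a]) (auto intro: fsupp_delta fsupp_zero)
  also have "\<dots> = lin ?g (lin (\<lambda>p. delta (path_class p)) a)"
    by (rule lin_class_factor[OF a])
      (auto simp: lin_delta lin_zero path_head_class path_class_def pcomp_def)
  finally show ?case by (simp add: lmul lin_zero)
next
  case (rmul a q)
  have a: "a \<in> fsupp UNIV" using Jideal_kQ[OF rmul(1)] by (auto simp: kQ_eq_fsupp intro: fsupp_UNIV)
  let ?f = "\<lambda>p. if fst p = path_head G q then delta (pcomp p q) else (\<lambda>_. 0 :: 'k)"
  let ?g = "\<lambda>c. if fst c = path_head G q then delta (fst q, mset (snd q) + snd c) else (\<lambda>_. 0 :: 'k)"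
  have "lin (\<lambda>p. delta (path_class p)) (kQmul G a (pvec q))
      = lin (\<lambda>t. lin (\<lambda>p. delta (path_class p)) (?f t)) a"
    unfolding pvec_eq_delta kQmul_delta_right[OF a]
    by (rule lin_lin[OF a]) (auto intro: fsupp_delta fsupp_zero)
  also have "\<dots> = lin ?g (lin (\<lambda>p. delta (path_class p)) a)"
    by (rule lin_class_factor[OF a])
      (auto simp: lin_delta lin_zero path_class_def pcomp_def)
  finally show ?case by (simp add: rmul lin_zero)
qed

section \<open>Reordering the labels of a path modulo \<open>Jideal\<close>\<close>

lemma Jideal_sum: "(\<And>i. i \<in> I \<Longrightarrow> f i \<in> Jideal n G) \<Longrightarrow> (\<lambda>t. \<Sum>i\<in>I. f i t) \<in> Jideal n G"
  by (induction I rule: infinite_finite_induct) (auto intro: Jideal.zero Jideal.add)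

abbreviation Jcong :: "'k path \<Rightarrow> 'k path \<Rightarrow> bool" where
  "Jcong p q \<equiv> (\<lambda>r. delta p r - delta q r) \<in> Jideal n G"

lemma Jcong_trans: "Jcong p q \<Longrightarrow> Jcong q r \<Longrightarrow> Jcong p r"
  using Jideal.add[of "\<lambda>t. delta p t - delta q t" n G "\<lambda>t. delta q t - delta r t"] by simp

lemma Jcong_sym: "Jcong p q \<Longrightarrow> Jcong q p"
  using Jideal.smul[of "\<lambda>t. delta p t - delta q t" n G "-1"] by simp

lemma Jcong_refl: "Jcong p p"
  using Jideal.zero by simp

lemma Jcong_Cons:
  assumes "Jcong (path_head G (\<chi>, [i]), l) (path_head G (\<chi>, [i]), l')" "\<chi> \<in> Gdual G" "i < n"
  shows "Jcong (\<chi>, i # l) (\<chi>, i # l')"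
proof -
  have "kQmul G (\<lambda>r. delta (path_head G (\<chi>, [i]), l) r - delta (path_head G (\<chi>, [i]), l') r) (pvec (\<chi>, [i]))
    \<in> Jideal n G"
    by (rule Jideal.rmul[OF assms(1)]) (use assms in \<open>simp add: valid_path_def\<close>)
  then show ?thesis
    unfolding pvec_eq_delta
    by (subst (asm) kQmul_delta_right) (auto simp: lin_diff lin_delta fsupp_diff fsupp_delta pcomp_def)
qed

lemma Jcong_swap:
  assumes \<chi>: "\<chi> \<in> Gdual G" and "i < n" "j < n" "set l \<subseteq> {..<n}"
  shows "Jcong (\<chi>, i # j # l) (\<chi>, j # i # l)"
proof -
  have main: "Jcong (\<chi>, j # i # l) (\<chi>, i # j # l)" if "i < j" "j < n" for i j
  proof -
    \<comment> \<open>The rest of the path, starting at the common head of both sides of the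
      relation; composing it on the left appends \<open>l\<close> to each side.\<close>
    let ?p = "(path_head G (\<chi>, [i, j]), l)"
    have "path_head G (\<chi>, [j, i]) = path_head G (\<chi>, [i, j])"
      by (simp add: path_head_eq add_mset_commute)
    moreover have "kQmul G (pvec ?p) (comm_rel \<chi> i j) \<in> Jideal n G"
      using that assms
      by (intro Jideal.lmul Jideal.gen) (auto simp: valid_path_def intro: path_head_Gdual)
    ultimately show ?thesis
      unfolding pvec_eq_delta comm_rel_def
      by (subst (asm) kQmul_delta_left) (auto simp: lin_diff lin_delta fsupp_diff fsupp_delta pcomp_def)
  qed
  consider "i < j" | "i = j" | "j < i" by linarith
  then show ?thesis
    by cases (use main assms in \<open>auto intro: Jcong_sym Jcong_refl Jideal.zero\<close>)
qed

lemma Jcong_move_front: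
  assumes "\<chi> \<in> Gdual G" "i < n" "set l \<subseteq> {..<n}" "set l' \<subseteq> {..<n}"
  shows "Jcong (\<chi>, i # l @ l') (\<chi>, l @ i # l')"
  using assms
proof (induction l arbitrary: \<chi>)
  case (Cons j l)
  have "Jcong (\<chi>, i # j # l @ l') (\<chi>, j # i # l @ l')"
    using Cons.prems by (intro Jcong_swap) auto
  moreover have "Jcong (\<chi>, j # i # l @ l') (\<chi>, j # l @ i # l')"
    using Cons.prems by (intro Jcong_Cons Cons.IH path_head_Gdual) (auto simp: valid_path_def)
  ultimately show ?case by (auto intro: Jcong_trans)
qed (simp add: Jideal.zero)

lemma Jcong_perm:
  assumes "\<chi> \<in> Gdual G" "set l \<subseteq> {..<n}" "mset l = mset l'"
  shows "Jcong (\<chi>, l) (\<chi>, l')"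
  using assms
proof (induction l arbitrary: \<chi> l')
  case (Cons i l)
  have "i \<in> set l'" using Cons.prems(3) by (metis list.set_intros(1) mset_eq_setD)
  then obtain a b where l': "l' = a @ i # b" by (auto simp: in_set_conv_decomp)
  have set: "set l' \<subseteq> {..<n}" using Cons.prems by (metis mset_eq_setD)
  have "Jcong (\<chi>, i # l) (\<chi>, i # (a @ b))"
    using Cons.prems l' by (intro Jcong_Cons Cons.IH path_head_Gdual) (auto simp: valid_path_def)
  moreover have "Jcong (\<chi>, i # (a @ b)) (\<chi>, l')"
    unfolding l' using Cons.prems set l' by (intro Jcong_move_front) auto
  ultimately show ?case by (rule Jcong_trans)
qed (simp add: Jideal.zero)

lemma Jcong_sorted: "valid_path n G p \<Longrightarrow> Jcong p (sorted_path (path_class p))"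
  using Jcong_perm[of "fst p" "snd p" "sorted_list_of_multiset (mset (snd p))"]
  by (simp add: valid_path_def sorted_path_def path_class_def)

text \<open>For the converse, replacing every path by its sorted form changes \<open>a\<close> by an
  element of the ideal, and the result is computed from the pushforward of \<open>a\<close>, which
  is zero.\<close>

lemma Jideal_iff:
  "a \<in> Jideal n G \<longleftrightarrow> a \<in> kQ n G \<and> lin (\<lambda>p. delta (path_class p)) a = (\<lambda>_. 0 :: 'k)"
proof safe
  assume a: "a \<in> kQ n G" and zero: "lin (\<lambda>p. delta (path_class p)) a = (\<lambda>_. 0 :: 'k)"
  have "(\<lambda>r. lin delta a r - lin (\<lambda>p. delta (sorted_path (path_class p))) a r) \<in> Jideal n G"
    unfolding lin_def sum_subtractf[symmetric] right_diff_distrib[symmetric]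
    by (intro Jideal_sum Jideal.smul Jcong_sorted) (use a in \<open>auto simp: kQ_def\<close>)
  moreover have "lin (\<lambda>p. delta (sorted_path (path_class p))) a =
      lin (\<lambda>c. delta (sorted_path c)) (lin (\<lambda>p. delta (path_class p)) a)"
    by (rule lin_class_factor) (use a in \<open>auto simp: kQ_eq_fsupp\<close>)
  ultimately show "a \<in> Jideal n G"
    using zero a by (simp add: lin_zero lin_delta_id[of a, OF a[unfolded kQ_eq_fsupp]])
qed (auto simp: Jideal_kQ Jideal_class_zero)

end

section \<open>Cells of the torus\<close>

lemma mem_cube:
  "x \<in> cube u S \<longleftrightarrow> (\<forall>j. if j \<in> S then of_int (u j) \<le> x j \<and> x j \<le> of_int (u j) + 1 else x j = of_int (u j))"
proof
  assume "x \<in> cube u S"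
  then show "\<forall>j. if j \<in> S then of_int (u j) \<le> x j \<and> x j \<le> of_int (u j) + 1 else x j = of_int (u j)"
    by (auto simp: cube_def)
next
  assume *: "\<forall>j. if j \<in> S then of_int (u j) \<le> x j \<and> x j \<le> of_int (u j) + 1 else x j = of_int (u j)"
  show "x \<in> cube u S"
    unfolding cube_def
  proof (intro CollectI exI[of _ "\<lambda>j. x j - of_int (u j)"] conjI ballI ext)
    fix j
    show "j \<in> S \<Longrightarrow> 0 \<le> x j - of_int (u j)" "j \<in> S \<Longrightarrow> x j - of_int (u j) \<le> 1"
      using *[rule_format, of j] by auto
    show "x j = of_int (u j) + (if j \<in> S then x j - of_int (u j) else 0)"
      using *[rule_format, of j] by auto
  qed
qed

text \<open>Containment is already decided by two corners of the smaller cube, \<open>w\<close> and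
  \<open>w + ind T\<close>; integrality of the corners leaves only two values for each
  coordinate.\<close>

lemma cube_subset_iff:
  "cube w T \<subseteq> cube u S \<longleftrightarrow> T \<subseteq> S \<and> (\<forall>i. w i = u i \<or> (w i = u i + 1 \<and> i \<in> S - T))"
proof
  assume sub: "cube w T \<subseteq> cube u S"
  have low: "(\<lambda>j. of_int (w j)) \<in> cube u S"
    using sub by (rule subsetD) (simp add: mem_cube)
  have high: "(\<lambda>j. of_int (w j) + (if j \<in> T then 1 else 0)) \<in> cube u S"
    using sub by (rule subsetD) (simp add: mem_cube)
  have pt: "(i \<in> T \<longrightarrow> i \<in> S) \<and> (w i = u i \<or> (w i = u i + 1 \<and> i \<in> S - T))" for i
  proof -
    have "if i \<in> S then u i \<le> w i \<and> w i \<le> u i + 1 else w i = u i"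
      using low[unfolded mem_cube, rule_format, of i] by (auto split: if_splits)
    moreover have "if i \<in> S then w i + (if i \<in> T then 1 else 0) \<le> u i + 1
        else w i + (if i \<in> T then 1 else 0) = u i"
    proof (cases "i \<in> S")
      case True
      then have "(of_int (w i + (if i \<in> T then 1 else 0)) :: real) \<le> of_int (u i + 1)"
        using high[unfolded mem_cube, rule_format, of i] by auto
      then show ?thesis using True unfolding of_int_le_iff by simp
    next
      case False
      then have "(of_int (w i + (if i \<in> T then 1 else 0)) :: real) = of_int (u i)"
        using high[unfolded mem_cube, rule_format, of i] by auto
      then show ?thesis using False unfolding of_int_eq_iff by simp
    qed
    ultimately show ?thesis by (auto split: if_splits)
  qed
  then show "T \<subseteq> S \<and> (\<forall>i. w i = u i \<or> (w i = u i + 1 \<and> i \<in> S - T))" by blast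
next
  assume *: "T \<subseteq> S \<and> (\<forall>i. w i = u i \<or> (w i = u i + 1 \<and> i \<in> S - T))"
  show "cube w T \<subseteq> cube u S"
  proof
    fix x assume x: "x \<in> cube w T"
    show "x \<in> cube u S"
      unfolding mem_cube
    proof
      fix i
      show "if i \<in> S then of_int (u i) \<le> x i \<and> x i \<le> of_int (u i) + 1 else x i = of_int (u i)"
        using * x[unfolded mem_cube, rule_format, of i] by (auto split: if_splits dest: spec[of _ i])
    qed
  qed
qed

lemma facet_cube_iff:
  assumes "finite S"
  shows "card T + 1 = card S \<and> cube w T \<subseteq> cube u S \<longleftrightarrow>
    (\<exists>i\<in>S. T = S - {i} \<and> (w = u \<or> w = vplus u (ind {i})))"
proof
  assume "card T + 1 = card S \<and> cube w T \<subseteq> cube u S"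
  then have c: "card T + 1 = card S" and sub: "cube w T \<subseteq> cube u S" by auto
  from sub have T: "T \<subseteq> S" and w: "\<forall>i. w i = u i \<or> (w i = u i + 1 \<and> i \<in> S - T)"
    by (auto simp: cube_subset_iff)
  have "card (S - T) = 1" using c T assms by (simp add: card_Diff_subset finite_subset)
  then obtain i where i: "S - T = {i}" by (auto simp: card_1_singleton_iff)
  then have "i \<in> S" "T = S - {i}" using T by auto
  moreover have "w = u \<or> w = vplus u (ind {i})"
  proof (cases "w i = u i")
    case True
    then have "w = u" using w i by (metis ext singletonD)
    then show ?thesis ..
  next
    case False
    then have "w = vplus u (ind {i})" using w i by (auto simp: vplus_def ind_def fun_eq_iff)
    then show ?thesis ..
  qed
  ultimately show "\<exists>i\<in>S. T = S - {i} \<and> (w = u \<or> w = vplus u (ind {i}))" by blast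
next
  assume "\<exists>i\<in>S. T = S - {i} \<and> (w = u \<or> w = vplus u (ind {i}))"
  then obtain i where i: "i \<in> S" "T = S - {i}" "w = u \<or> w = vplus u (ind {i})" by blast
  moreover have "card T + 1 = card S" using i assms by (metis Suc_eq_plus1 card_Suc_Diff1)
  ultimately show "card T + 1 = card S \<and> cube w T \<subseteq> cube u S"
    unfolding cube_subset_iff by (elim disjE) (simp_all add: vplus_def ind_def)
qed

lemma labels_of_zero: "labels_of n (\<lambda>_. 0) = []"
  by (simp add: labels_of_def)

lemma labels_of_unit:
  assumes "i < n" shows "labels_of n (ind {i}) = [i]"
proof -
  have e: "concat (map (\<lambda>k. replicate (nat (ind {i} k)) k) xs) = []" if "i \<notin> set xs" for xs
    using that by (induction xs) (auto simp: ind_def)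
  have "[0..<n] = [0..<i] @ i # [Suc i..<n]"
    using assms upt_add_eq_append[of 0 i "n - i"] by (simp add: upt_conv_Cons)
  then show ?thesis
    unfolding labels_of_def by (simp add: e) (simp add: ind_def)
qed

text \<open>Recovers the directions from the point set without choosing a lift: translations by M
  are integral, so they preserve which coordinates are integers.\<close>

definition cell_dirs :: "cell \<Rightarrow> nat set" where
  "cell_dirs \<eta> = {i. \<exists>y\<in>\<eta>. y i \<notin> \<int>}"

context diag_group
begin

text \<open>Normal form of a cell: two lifts with equal directions differ by an element of M exactly
  when their degrees agree, so tail and directions name the cell.\<close>

definition cell_of :: "'k chr \<Rightarrow> nat set \<Rightarrow> cell" where
  "cell_of \<chi> S = (\<Union>w\<in>{w \<in> Zn n. degZ n G w = \<chi>}. cube w S)"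

lemma degZ_vplus: "degZ n G (vplus u v) = chmul (degZ n G u) (degZ n G v)"
  by (auto simp: degZ_def chmul_def vplus_def fun_eq_iff power_int_add G_nonzero prod.distrib)

lemma degZ_zero: "degZ n G (\<lambda>_. 0) = (\<lambda>_. 1)"
  by (auto simp: degZ_def)

lemma degZ_neg: "degZ n G (\<lambda>i. - u i) = (\<lambda>g. inverse (degZ n G u g))"
  by (auto simp: degZ_def fun_eq_iff power_int_minus prod_inversef[symmetric])

lemma degZ_nonzero: "degZ n G u g \<noteq> 0"
  by (auto simp: degZ_def G_nonzero)

lemma degZ_Gdual: "degZ n G u \<in> Gdual G"
  by (auto simp: degZ_def Gdual_def G_nonzero G_mult power_int_mult_distrib prod.distrib)

lemma degZ_ind: "S \<subseteq> {..<n} \<Longrightarrow> degZ n G (vplus u (ind S)) = chr_shift G (degZ n G u) (mset_set S)"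
proof
  fix g assume S: "S \<subseteq> {..<n}"
  have fin: "finite S" using S finite_subset by blast
  show "degZ n G (vplus u (ind S)) g = chr_shift G (degZ n G u) (mset_set S) g"
  proof (cases "g \<in> G")
    case True
    have "degZ n G (ind S) g = (\<Prod>i\<in>{..<n}. if i \<in> S then g i else 1)"
      using True by (auto simp: degZ_def ind_def intro!: prod.cong)
    also have "\<dots> = (\<Prod>i\<in>{..<n} \<inter> S. g i)" by (rule prod.inter_restrict[symmetric]) simp
    also have "\<dots> = (\<Prod>i\<in>S. g i)" using S by (simp add: Int_absorb1)
    finally show ?thesis
      using True by (simp add: degZ_vplus chmul_def chr_shift_def rho_def prod_unfold_prod_mset)
  next
    case False
    then show ?thesis by (simp add: degZ_def chr_shift_def rho_def)
  qed
qed

lemma degZ_unit: "i < n \<Longrightarrow> degZ n G (vplus u (ind {i})) = chr_shift G (degZ n G u) {#i#}"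
  using degZ_ind[of "{i}" u] by simp

lemma Zn_ind: "u \<in> Zn n \<Longrightarrow> S \<subseteq> {..<n} \<Longrightarrow> vplus u (ind S) \<in> Zn n"
  by (auto simp: Zn_def vplus_def ind_def)

lemma cellimg_eq: "u \<in> Zn n \<Longrightarrow> cellimg n G u S = cell_of (degZ n G u) S"
proof (intro set_eqI iffI)
  fix y assume u: "u \<in> Zn n" and "y \<in> cellimg n G u S"
  then obtain x m where x: "x \<in> cube u S" and m: "m \<in> Mlat n G" and y: "y = (\<lambda>j. x j + of_int (m j))"
    by (auto simp: cellimg_def)
  have "y \<in> cube (vplus u m) S"
    unfolding mem_cube
  proof
    fix j show "if j \<in> S then real_of_int (vplus u m j) \<le> y j \<and> y j \<le> real_of_int (vplus u m j) + 1
        else y j = real_of_int (vplus u m j)"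
      using x[unfolded mem_cube, rule_format, of j] by (auto simp: vplus_def y)
  qed
  moreover have "vplus u m \<in> Zn n" "degZ n G (vplus u m) = degZ n G u"
    using u m by (auto simp: Mlat_def Zn_def vplus_def)
      (simp add: degZ_vplus[unfolded vplus_def] degZ_zero chmul_def)
  ultimately show "y \<in> cell_of (degZ n G u) S" by (auto simp: cell_of_def)
next
  fix y assume u: "u \<in> Zn n" and "y \<in> cell_of (degZ n G u) S"
  then obtain w where w: "w \<in> Zn n" "degZ n G w = degZ n G u" and y: "y \<in> cube w S"
    by (auto simp: cell_of_def)
  let ?m = "vplus w (\<lambda>i. - u i)"
  have "?m \<in> Mlat n G"
    using u w by (auto simp: Mlat_def Zn_def degZ_vplus degZ_neg degZ_zero chmul_def degZ_nonzero)
      (simp add: vplus_def)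
  moreover have "(\<lambda>j. y j - of_int (?m j)) \<in> cube u S"
    unfolding mem_cube
  proof
    fix j show "if j \<in> S then real_of_int (u j) \<le> y j - real_of_int (?m j) \<and>
            y j - real_of_int (?m j) \<le> real_of_int (u j) + 1
         else y j - real_of_int (?m j) = real_of_int (u j)"
      using y[unfolded mem_cube, rule_format, of j] by (auto simp: vplus_def)
  qed
  ultimately show "y \<in> cellimg n G u S" unfolding cellimg_def by force
qed

text \<open>The functional \<open>f \<mapsto> \<Sum>\<^bsub>g\<^esub> \<chi>(g)\<^sup>-\<^sup>1 f(g)\<close> kills every monomial character different from \<open>\<chi>\<close>,
  but monomials span all functions on \<open>G\<close> because the coordinates separate points.\<close>

lemma degZ_surj:
  assumes \<chi>: "\<chi> \<in> Gdual G"
  shows "\<exists>u\<in>Zn n. degZ n G u = \<chi>"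
proof (rule ccontr)
  assume "\<not> ?thesis"
  then have ne: "\<And>u. u \<in> Zn n \<Longrightarrow> degZ n G u \<noteq> \<chi>" by blast
  define L where "L f = (\<Sum>g\<in>G. inverse (\<chi> g) * f g)" for f :: "'k diag \<Rightarrow> 'k"
  have \<chi>0: "\<chi> g \<noteq> 0" if "g \<in> G" for g using \<chi> that by (auto simp: Gdual_def)
  have ortho: "L (degZ n G u) = 0" if u: "u \<in> Zn n" for u
  proof -
    define \<psi> where "\<psi> g = inverse (\<chi> g) * degZ n G u g" for g
    obtain h where "degZ n G u h \<noteq> \<chi> h" using ne[OF u] by blast
    moreover have "h \<in> G"
      using calculation \<chi> by (auto simp: degZ_def Gdual_def split: if_splits)
    ultimately have h: "h \<in> G" "\<psi> h \<noteq> 1" using \<chi>0[of h] by (auto simp: \<psi>_def field_simps)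
    have mult: "\<psi> (\<lambda>i. h i * g i) = \<psi> h * \<psi> g" if "g \<in> G" for g
      using \<chi> degZ_Gdual[of u] h(1) that by (auto simp: \<psi>_def Gdual_def)
    \<comment> \<open>Orthogonality of characters: translation by \<open>h\<close> permutes
      \<open>G\<close> and multiplies \<open>\<psi>\<close> by a constant different from 1.\<close>
    have "(\<Sum>g\<in>G. \<psi> (\<lambda>i. h i * g i)) = (\<Sum>g\<in>G. \<psi> g)"
      by (rule sum.reindex_bij_witness[of _ "\<lambda>g i. inverse (h i) * g i" "\<lambda>g i. h i * g i"])
        (auto simp: G_mult G_inv h G_nonzero mult.assoc[symmetric])
    then have "\<psi> h * (\<Sum>g\<in>G. \<psi> g) = (\<Sum>g\<in>G. \<psi> g)"
      by (simp add: mult sum_distrib_left)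
    then have "(\<Sum>g\<in>G. \<psi> g) = 0" using h(2) by auto
    then show ?thesis by (simp add: L_def \<psi>_def)
  qed
  \<comment> \<open>Functions all of whose monomial multiples are killed by \<open>L\<close>.
    Multiplying by \<open>g i - h i\<close> stays in this set and creates a zero at
    \<open>h\<close>; when \<open>h i\<close> differs from 1 the value at the identity remains
    nonzero.\<close>
  define K where "K f \<longleftrightarrow> (\<forall>u\<in>Zn n. L (\<lambda>g. f g * degZ n G u g) = 0)" for f
  have "\<exists>f. K f \<and> f (\<lambda>_. 1) \<noteq> 0 \<and> (\<forall>h\<in>F. f h = 0)" if "finite F" "F \<subseteq> G - {\<lambda>_. 1}" for F
    using that
  proof (induction F)
    case empty
    then show ?case using ortho by (intro exI[of _ "\<lambda>_. 1"]) (auto simp: K_def)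
  next
    case (insert h F)
    then obtain f where f: "K f" "f (\<lambda>_. 1) \<noteq> 0" "\<And>h. h \<in> F \<Longrightarrow> f h = 0" by auto
    have "h \<noteq> (\<lambda>_. 1)" using insert by auto
    then obtain i where i: "h i \<noteq> 1" by (auto simp: fun_eq_iff)
    then have "i < n" using insert G_outside[of h i] by force
    have "K (\<lambda>g. f g * (g i - h i))"
      unfolding K_def
    proof
      fix u assume u: "u \<in> Zn n"
      have "L (\<lambda>g. f g * (g i - h i) * degZ n G u g)
        = L (\<lambda>g. f g * degZ n G (vplus u (ind {i})) g) - h i * L (\<lambda>g. f g * degZ n G u g)"
        unfolding L_def sum_distrib_left sum_subtractf[symmetric]
        by (rule sum.cong) (auto simp: degZ_unit[OF \<open>i < n\<close>] chr_shift_def rho_def algebra_simps)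
      also have "\<dots> = 0"
        using f(1) u Zn_ind[OF u, of "{i}"] \<open>i < n\<close> by (auto simp: K_def)
      finally show "L (\<lambda>g. f g * (g i - h i) * degZ n G u g) = 0" .
    qed
    then show ?case using f i by (intro exI[of _ "\<lambda>g. f g * (g i - h i)"]) auto
  qed
  from this[of "G - {\<lambda>_. 1}"] obtain f where f: "K f" "f (\<lambda>_. 1) \<noteq> 0" "\<And>h. h \<in> G - {\<lambda>_. 1} \<Longrightarrow> f h = 0"
    using G_finite by auto
  \<comment> \<open>\<open>f\<close> is now supported at the identity alone, so \<open>L\<close> has
    a single nonzero term, contradicting \<open>K f\<close> at exponent zero.\<close>
  have "L (\<lambda>g. f g * degZ n G (\<lambda>_. 0) g) = (\<Sum>g\<in>{\<lambda>_. 1}. inverse (\<chi> g) * f g)"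
    unfolding L_def degZ_zero
    by (rule sum.mono_neutral_cong_right) (use f G_finite G_one in auto)
  moreover have "(\<lambda>_. 0) \<in> Zn n" by (simp add: Zn_def)
  ultimately show False using f \<chi>0[OF G_one] by (auto simp: K_def)
qed

lemma cell_dirs_cell_of:
  assumes "\<chi> \<in> Gdual G" shows "cell_dirs (cell_of \<chi> S) = S"
proof (intro set_eqI iffI)
  fix i assume "i \<in> cell_dirs (cell_of \<chi> S)"
  then obtain y w where "y \<in> cube w S" "y i \<notin> \<int>" by (auto simp: cell_dirs_def cell_of_def)
  then show "i \<in> S" unfolding mem_cube by (metis Ints_of_int)
next
  fix i assume i: "i \<in> S"
  obtain u where u: "u \<in> Zn n" "degZ n G u = \<chi>" using degZ_surj[OF assms] by blast
  let ?y = "\<lambda>j. real_of_int (u j) + (if j \<in> S then 1/2 else 0)"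
  have "?y \<in> cell_of \<chi> S" using u by (auto simp: cell_of_def mem_cube)
  moreover have "?y i \<notin> \<int>"
  proof
    assume "?y i \<in> \<int>"
    then obtain z where "real_of_int (u i) + 1/2 = of_int z" using i by (auto elim: Ints_cases)
    then have "real_of_int (2 * u i + 1) = of_int (2 * z)" by simp
    then have "2 * u i + 1 = 2 * z" by (simp only: of_int_eq_iff)
    then show False by presburger
  qed
  ultimately show "i \<in> cell_dirs (cell_of \<chi> S)"
    unfolding cell_dirs_def by (intro CollectI bexI[of _ ?y])
qed

text \<open>The centre of a cube, with offset 1/2 in the directions \<open>S\<close>, lies in no
  other lattice cube with the same directions. Its membership therefore identifies the lift, and
  with it the tail.\<close>

lemma cell_of_eq_iff:
  assumes "\<chi> \<in> Gdual G" "\<psi> \<in> Gdual G"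
  shows "cell_of \<chi> S = cell_of \<psi> T \<longleftrightarrow> \<chi> = \<psi> \<and> S = T"
proof safe
  assume eq: "cell_of \<chi> S = cell_of \<psi> T"
  then have ST: "S = T" using cell_dirs_cell_of assms by metis
  obtain u where u: "u \<in> Zn n" "degZ n G u = \<chi>" using degZ_surj[OF assms(1)] by blast
  let ?y = "\<lambda>j. real_of_int (u j) + (if j \<in> S then 1/2 else 0)"
  have "?y \<in> cell_of \<chi> S" using u by (auto simp: cell_of_def mem_cube)
  then have "?y \<in> cell_of \<psi> S" using eq ST by simp
  then obtain w where w: "w \<in> Zn n" "degZ n G w = \<psi>" and y: "?y \<in> cube w S"
    by (auto simp: cell_of_def)
  have "u j = w j" for j
  proof -
    have "real_of_int (w j) < of_int (u j + 1) \<and> real_of_int (u j) < of_int (w j + 1)"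
      using y[unfolded mem_cube, rule_format, of j] by (cases "j \<in> S") auto
    then show ?thesis unfolding of_int_less_iff by simp
  qed
  then have "u = w" by blast
  then show "\<chi> = \<psi>" using u w by simp
  show "x \<in> S \<Longrightarrow> x \<in> T" "x \<in> T \<Longrightarrow> x \<in> S" for x using ST by auto
qed

section \<open>Lifts, tails, heads and facets in normal form\<close>

lemma is_lift_cell_of:
  assumes "\<chi> \<in> Gdual G" "S \<subseteq> {..<n}"
  shows "is_lift n G (cell_of \<chi> S) u T \<longleftrightarrow> u \<in> Zn n \<and> degZ n G u = \<chi> \<and> T = S"
  using assms by (auto simp: is_lift_def cellimg_eq cell_of_eq_iff degZ_Gdual)

lemma ex_lift_cell_of:
  assumes "\<chi> \<in> Gdual G" "S \<subseteq> {..<n}"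
  shows "\<exists>u. is_lift n G (cell_of \<chi> S) u S"
  using degZ_surj[OF assms(1)] by (auto simp: is_lift_cell_of[OF assms])

lemma Delta_k_eq: "Delta_k n G k = {cell_of \<chi> S |\<chi> S. \<chi> \<in> Gdual G \<and> S \<subseteq> {..<n} \<and> card S = k}"
proof (intro set_eqI iffI)
  fix \<eta> assume "\<eta> \<in> Delta_k n G k"
  then obtain u S where "u \<in> Zn n" "S \<subseteq> {..<n}" "\<eta> = cellimg n G u S" "card S = k"
    by (auto simp: Delta_k_def is_lift_def)
  then show "\<eta> \<in> {cell_of \<chi> S |\<chi> S. \<chi> \<in> Gdual G \<and> S \<subseteq> {..<n} \<and> card S = k}"
    using degZ_Gdual[of u] by (auto simp: cellimg_eq)
next
  fix \<eta> assume "\<eta> \<in> {cell_of \<chi> S |\<chi> S. \<chi> \<in> Gdual G \<and> S \<subseteq> {..<n} \<and> card S = k}"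
  then obtain \<chi> S where *: "\<chi> \<in> Gdual G" "S \<subseteq> {..<n}" "card S = k" "\<eta> = cell_of \<chi> S" by blast
  then show "\<eta> \<in> Delta_k n G k" using ex_lift_cell_of[OF *(1,2)] unfolding Delta_k_def by blast
qed

lemma cell_of_Delta: "\<chi> \<in> Gdual G \<Longrightarrow> S \<subseteq> {..<n} \<Longrightarrow> cell_of \<chi> S \<in> Delta n G"
  by (auto simp: Delta_def Delta_k_eq)

text \<open>Which lift \<open>SOME\<close> picks is unknown, but all lifts share their directions
  and their degree, which is all that \<open>cell_tail\<close> and \<open>cell_head\<close>
  use.\<close>

lemma some_lift_cell_of:
  assumes "\<chi> \<in> Gdual G" "S \<subseteq> {..<n}"
  obtains u where "(SOME (u, T). is_lift n G (cell_of \<chi> S) u T) = (u, S)" "u \<in> Zn n" "degZ n G u = \<chi>"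
proof -
  have ex: "\<exists>x. case x of (u, T) \<Rightarrow> is_lift n G (cell_of \<chi> S) u T"
    using ex_lift_cell_of[OF assms] by auto
  obtain u T where uT: "(SOME (u, T). is_lift n G (cell_of \<chi> S) u T) = (u, T)"
    by (meson surj_pair)
  have "is_lift n G (cell_of \<chi> S) u T" using someI_ex[OF ex] unfolding uT by simp
  then show thesis using that uT by (simp add: is_lift_cell_of[OF assms])
qed

lemma cell_tail_cell_of:
  assumes "\<chi> \<in> Gdual G" "S \<subseteq> {..<n}" shows "cell_tail n G (cell_of \<chi> S) = \<chi>"
  by (rule some_lift_cell_of[OF assms]) (simp add: cell_tail_def)

lemma cell_head_cell_of:
  assumes "\<chi> \<in> Gdual G" "S \<subseteq> {..<n}"
  shows "cell_head n G (cell_of \<chi> S) = chr_shift G \<chi> (mset_set S)"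
  by (rule some_lift_cell_of[OF assms]) (simp add: cell_head_def degZ_ind assms)

lemma is_facet_cell_of:
  assumes \<chi>: "\<chi> \<in> Gdual G" and S: "S \<subseteq> {..<n}" "S \<noteq> {}"
  shows "is_facet n G \<eta> (cell_of \<chi> S) \<longleftrightarrow>
    (\<exists>i\<in>S. \<eta> = cell_of \<chi> (S - {i}) \<or> \<eta> = cell_of (chr_shift G \<chi> {#i#}) (S - {i}))"
proof -
  have fin: "finite S" using S finite_subset by blast
  \<comment> \<open>Discards the clause of \<open>is_facet\<close> about the empty face, which
    concerns vertices only.\<close>
  have "cell_of \<chi> S \<notin> Delta_k n G 0"
    using S fin \<chi> finite_subset by (auto simp: Delta_k_eq cell_of_eq_iff)
  then have facet_iff: "is_facet n G \<eta> (cell_of \<chi> S) \<longleftrightarrow>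
      (\<exists>w T u S'. face_lift n G \<eta> (cell_of \<chi> S) w T u S' \<and> card T + 1 = card S')"
    by (simp add: is_facet_def)
  show ?thesis
  proof
    assume "is_facet n G \<eta> (cell_of \<chi> S)"
    then obtain w T u S' where fl: "face_lift n G \<eta> (cell_of \<chi> S) w T u S'" and c: "card T + 1 = card S'"
      unfolding facet_iff by blast
    from fl have w: "is_lift n G \<eta> w T" and u: "u \<in> Zn n" "degZ n G u = \<chi>" and S': "S' = S"
      and sub: "cube w T \<subseteq> cube u S"
      unfolding face_lift_def is_lift_cell_of[OF \<chi> S(1)] by blast+
    from c sub S' have "card T + 1 = card S \<and> cube w T \<subseteq> cube u S" by simp
    then obtain i where i: "i \<in> S" "T = S - {i}" "w = u \<or> w = vplus u (ind {i})"
      unfolding facet_cube_iff[OF fin] by blast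
    have "i < n" using i S by auto
    have "\<eta> = cell_of (degZ n G w) T" using w by (simp add: is_lift_def cellimg_eq)
    then have "\<eta> = cell_of \<chi> (S - {i}) \<or> \<eta> = cell_of (chr_shift G \<chi> {#i#}) (S - {i})"
      using i u \<open>i < n\<close> by (elim disjE) (simp_all add: degZ_unit)
    then show "\<exists>i\<in>S. \<eta> = cell_of \<chi> (S - {i}) \<or> \<eta> = cell_of (chr_shift G \<chi> {#i#}) (S - {i})"
      using i(1) by blast
  next
    assume "\<exists>i\<in>S. \<eta> = cell_of \<chi> (S - {i}) \<or> \<eta> = cell_of (chr_shift G \<chi> {#i#}) (S - {i})"
    then obtain i where i: "i \<in> S" and \<eta>: "\<eta> = cell_of \<chi> (S - {i}) \<or> \<eta> = cell_of (chr_shift G \<chi> {#i#}) (S - {i})"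
      by blast
    obtain u where u: "u \<in> Zn n" "degZ n G u = \<chi>" using degZ_surj[OF \<chi>] by blast
    have "i < n" using i S by auto
    then have v: "vplus u (ind {i}) \<in> Zn n" "degZ n G (vplus u (ind {i})) = chr_shift G \<chi> {#i#}"
      using u Zn_ind[OF u(1), of "{i}"] by (simp_all add: degZ_unit)
    obtain w where w: "w = u \<or> w = vplus u (ind {i})" "w \<in> Zn n" "\<eta> = cell_of (degZ n G w) (S - {i})"
      using \<eta> u v by metis
    have "card (S - {i}) + 1 = card S \<and> cube w (S - {i}) \<subseteq> cube u S"
      unfolding facet_cube_iff[OF fin] using w i by blast
    moreover have "is_lift n G \<eta> w (S - {i})"
      using w S by (auto simp: is_lift_def cellimg_eq)
    moreover have "is_lift n G (cell_of \<chi> S) u S" using u is_lift_cell_of[OF \<chi> S(1)] by simp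
    ultimately show "is_facet n G \<eta> (cell_of \<chi> S)"
      unfolding facet_iff face_lift_def by blast
  qed
qed

lemma is_facet_low:
  assumes "\<chi> \<in> Gdual G" "S \<subseteq> {..<n}" "i \<in> S"
  shows "is_facet n G (cell_of \<chi> (S - {i})) (cell_of \<chi> S)"
  using is_facet_cell_of[OF assms(1,2)] assms(3) by blast

lemma is_facet_up:
  assumes "\<chi> \<in> Gdual G" "S \<subseteq> {..<n}" "i \<in> S"
  shows "is_facet n G (cell_of (chr_shift G \<chi> {#i#}) (S - {i})) (cell_of \<chi> S)"
  using is_facet_cell_of[OF assms(1,2)] assms(3) by blast

end

section \<open>Incidence numbers and derivatives\<close>

lemma mset_set_remove1: "finite S \<Longrightarrow> i \<in> S \<Longrightarrow> add_mset i (mset_set (S - {i})) = mset_set S"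
  by (metis mset_set.remove)

locale incidence = diag_group n G for n :: nat and G :: "'k::field diag set" +
  fixes \<epsilon> :: "cell \<Rightarrow> cell \<Rightarrow> int"
  assumes inc: "incidence_fun n G \<epsilon>"
begin

text \<open>Of the two facets of a cube orthogonal to \<open>i\<close>, \<open>eps_low\<close>
  belongs to the one through the tail corner and \<open>eps_up\<close> to its translate by the unit
  vector \<open>i\<close>.\<close>

definition eps_low :: "'k chr \<Rightarrow> nat set \<Rightarrow> nat \<Rightarrow> int" where
  "eps_low \<chi> S i = \<epsilon> (cell_of \<chi> S) (cell_of \<chi> (S - {i}))"

definition eps_up :: "'k chr \<Rightarrow> nat set \<Rightarrow> nat \<Rightarrow> int" where
  "eps_up \<chi> S i = \<epsilon> (cell_of \<chi> S) (cell_of (chr_shift G \<chi> {#i#}) (S - {i}))"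

lemma eps_facet:
  assumes "\<chi> \<in> Gdual G" "S \<subseteq> {..<n}" "\<psi> \<in> Gdual G" "T \<subseteq> {..<n}"
    and "is_facet n G (cell_of \<psi> T) (cell_of \<chi> S)"
  shows "\<epsilon> (cell_of \<chi> S) (cell_of \<psi> T) \<in> {-1, 1}"
  using inc[unfolded incidence_fun_def, THEN conjunct1, rule_format,
      OF cell_of_Delta[OF assms(1,2)] cell_of_Delta[OF assms(3,4)]] assms(5)
  by auto

lemma eps_low_unit:
  assumes "\<chi> \<in> Gdual G" "S \<subseteq> {..<n}" "i \<in> S" shows "eps_low \<chi> S i \<in> {-1, 1}"
  unfolding eps_low_def using assms by (intro eps_facet is_facet_low) auto

lemma eps_up_unit:
  assumes "\<chi> \<in> Gdual G" "S \<subseteq> {..<n}" "i \<in> S" shows "eps_up \<chi> S i \<in> {-1, 1}"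
  unfolding eps_up_def using assms
  by (intro eps_facet chr_shift_Gdual is_facet_up) auto

text \<open>The four choices of \<open>T\<close> are the four faces of codimension two with
  directions \<open>S - {i, j}\<close>. A facet orthogonal to \<open>a\<close> contains such a face
  only if it lies on the same side in coordinate \<open>a\<close>, that is, is shifted exactly when
  \<open>a\<close> is in \<open>T\<close>.\<close>

lemma between_cubes:
  assumes S: "S \<subseteq> {..<n}" and u: "u \<in> Zn n" and ij: "i \<in> S" "j \<in> S" "i \<noteq> j" and T: "T \<subseteq> {i, j}"
  shows "{(w, S'). w \<in> Zn n \<and> S' \<subseteq> {..<n} \<and> card S' + 1 = card S \<and>
      cube (vplus u (ind T)) (S - {i, j}) \<subseteq> cube w S' \<and> cube w S' \<subseteq> cube u S} =
    {(vplus u (ind (T \<inter> {i})), S - {i}), (vplus u (ind (T \<inter> {j})), S - {j})}"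
    (is "?L = ?R")
proof
  have fin: "finite S" using S finite_subset by blast
  show "?L \<subseteq> ?R"
  proof
    fix x assume "x \<in> ?L"
    then obtain w S' where x: "x = (w, S')" and "card S' + 1 = card S \<and> cube w S' \<subseteq> cube u S"
      and sub: "cube (vplus u (ind T)) (S - {i, j}) \<subseteq> cube w S'" by auto
    then obtain a where a: "a \<in> S" "S' = S - {a}" and w: "w = u \<or> w = vplus u (ind {a})"
      unfolding facet_cube_iff[OF fin] by blast
    have "S - {i, j} \<subseteq> S - {a}" and "vplus u (ind T) a = w a"
      using sub a unfolding cube_subset_iff by auto
    then have "a = i \<or> a = j" "w = vplus u (ind (T \<inter> {a}))"
      using a w by (auto simp: vplus_def ind_def fun_eq_iff split: if_splits)
    then show "x \<in> ?R" using x a by blast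
  qed
  have "(vplus u (ind (T \<inter> {a})), S - {a}) \<in> ?L" if a: "a \<in> {i, j}" for a
  proof -
    have "card (S - {a}) + 1 = card S \<and> cube (vplus u (ind (T \<inter> {a}))) (S - {a}) \<subseteq> cube u S"
      unfolding facet_cube_iff[OF fin] using a ij
      by (cases "a \<in> T") (auto intro!: bexI[of _ a] simp: vplus_def ind_def)
    moreover have "cube (vplus u (ind T)) (S - {i, j}) \<subseteq> cube (vplus u (ind (T \<inter> {a}))) (S - {a})"
      unfolding cube_subset_iff using a ij T by (auto simp: vplus_def ind_def)
    moreover have "vplus u (ind (T \<inter> {a})) \<in> Zn n"
      using u S T ij by (intro Zn_ind) auto
    ultimately show ?thesis using S by auto
  qed
  then show "?R \<subseteq> ?L" by blast
qed

text \<open>The incidence axiom as a two-term identity. Taking \<open>T\<close> empty,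
  \<open>{j}\<close> and \<open>{i, j}\<close> gives the near-near, mixed and far-far sign rules
  that follow.\<close>

lemma eps_square:
  assumes \<chi>: "\<chi> \<in> Gdual G" and S: "S \<subseteq> {..<n}" and ij: "i \<in> S" "j \<in> S" "i \<noteq> j" and T: "T \<subseteq> {i, j}"
  defines "F \<equiv> \<lambda>T. cell_of (chr_shift G \<chi> (mset_set T))"
  shows "\<epsilon> (cell_of \<chi> S) (F (T \<inter> {i}) (S - {i})) * \<epsilon> (F (T \<inter> {i}) (S - {i})) (F T (S - {i, j})) +
    \<epsilon> (cell_of \<chi> S) (F (T \<inter> {j}) (S - {j})) * \<epsilon> (F (T \<inter> {j}) (S - {j})) (F T (S - {i, j})) = 0"
proof -
  obtain u where u: "u \<in> Zn n" "degZ n G u = \<chi>" using degZ_surj[OF \<chi>] by blast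
  have fin: "finite S" using S finite_subset by blast
  have img: "cellimg n G (vplus u (ind T')) S' = F T' S'" if "T' \<subseteq> T" for T' S'
  proof -
    have "T' \<subseteq> {..<n}" using that T ij S by auto
    then show ?thesis using u by (simp add: F_def cellimg_eq Zn_ind degZ_ind)
  qed
  have "card S = card (S - {i, j}) + 2"
    using ij fin card_mono[of S "{i,j}"] by (simp add: card_Diff_subset)
  moreover have "cube (vplus u (ind T)) (S - {i, j}) \<subseteq> cube u S"
    unfolding cube_subset_iff using ij T by (auto simp: vplus_def ind_def)
  moreover have "vplus u (ind T) \<in> Zn n" using u S T ij by (intro Zn_ind) auto
  ultimately have "(\<Sum>(u', S')\<in>{(w, S'). w \<in> Zn n \<and> S' \<subseteq> {..<n} \<and> card S' + 1 = card S \<and>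
      cube (vplus u (ind T)) (S - {i, j}) \<subseteq> cube w S' \<and> cube w S' \<subseteq> cube u S}.
     \<epsilon> (cellimg n G u S) (cellimg n G u' S') *
     \<epsilon> (cellimg n G u' S') (cellimg n G (vplus u (ind T)) (S - {i, j}))) = 0"
    using S u by (intro inc[unfolded incidence_fun_def, THEN conjunct2, THEN conjunct2, THEN conjunct2,
          rule_format]) auto
  \<comment> \<open>Keeps the two intermediate facets distinct, so that the sum over their set
    really has two terms.\<close>
  moreover have "S - {i} \<noteq> S - {j}" using ij by blast
  ultimately show ?thesis
    unfolding between_cubes[OF S u(1) ij T] by (simp add: img cellimg_eq u)
qed

lemma eps_low_low:
  assumes "\<chi> \<in> Gdual G" "S \<subseteq> {..<n}" "i \<in> S" "j \<in> S" "i \<noteq> j"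
  shows "eps_low \<chi> S i * eps_low \<chi> (S - {i}) j + eps_low \<chi> S j * eps_low \<chi> (S - {j}) i = 0"
  using eps_square[OF assms, of "{}"]
  by (simp add: eps_low_def Diff_insert2[symmetric] insert_commute)

lemma eps_low_up:
  assumes "\<chi> \<in> Gdual G" "S \<subseteq> {..<n}" "i \<in> S" "j \<in> S" "i \<noteq> j"
  shows "eps_low \<chi> S i * eps_up \<chi> (S - {i}) j + eps_up \<chi> S j * eps_low (chr_shift G \<chi> {#j#}) (S - {j}) i = 0"
  using eps_square[OF assms, of "{j}"] assms(5)
  by (simp add: eps_low_def eps_up_def Diff_insert2[symmetric] insert_commute)

lemma eps_up_up:
  assumes "\<chi> \<in> Gdual G" "S \<subseteq> {..<n}" "i \<in> S" "j \<in> S" "i \<noteq> j"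
  shows "eps_up \<chi> S i * eps_up (chr_shift G \<chi> {#i#}) (S - {i}) j +
    eps_up \<chi> S j * eps_up (chr_shift G \<chi> {#j#}) (S - {j}) i = 0"
  using eps_square[OF assms, of "{i, j}"] assms(5)
  by (simp add: eps_up_def Diff_insert2[symmetric] insert_commute chr_shift_union add_mset_commute)

text \<open>The incidence axiom at the empty face: vertices have incidence 1 with it, so the two
  ends of an edge carry opposite signs.\<close>

lemma eps_edge:
  assumes \<chi>: "\<chi> \<in> Gdual G" and i: "i < n"
  shows "eps_low \<chi> {i} i + eps_up \<chi> {i} i = 0"
proof -
  obtain u where u: "u \<in> Zn n" "degZ n G u = \<chi>" using degZ_surj[OF \<chi>] by blast
  have v: "vplus u (ind {i}) \<in> Zn n" "degZ n G (vplus u (ind {i})) = chr_shift G \<chi> {#i#}"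
    using u i Zn_ind[OF u(1), of "{i}"] by (simp_all add: degZ_unit)
  have ends: "{w. w \<in> Zn n \<and> cube w {} \<subseteq> cube u {i}} = {u, vplus u (ind {i})}"
  proof -
    have "cube w {} \<subseteq> cube u {i} \<longleftrightarrow> w = u \<or> w = vplus u (ind {i})" for w
      using facet_cube_iff[of "{i}" "{}" w u] by simp
    then show ?thesis using u v by blast
  qed
  have ne: "u \<noteq> vplus u (ind {i})" by (simp add: vplus_def ind_def fun_eq_iff)
  have one: "\<epsilon> (cell_of \<psi> {}) {} = 1" if "\<psi> \<in> Gdual G" for \<psi>
  proof -
    have "cell_of \<psi> {} \<in> Delta_k n G 0"
      unfolding Delta_k_eq using that by (intro CollectI exI[of _ \<psi>] exI[of _ "{}"]) simp
    then show ?thesis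
      using inc[unfolded incidence_fun_def, THEN conjunct2, THEN conjunct1] by blast
  qed
  have "(\<Sum>w\<in>{w. w \<in> Zn n \<and> cube w {} \<subseteq> cube u {i}}.
      \<epsilon> (cellimg n G u {i}) (cellimg n G w {}) * \<epsilon> (cellimg n G w {}) {}) = 0"
    using inc[unfolded incidence_fun_def, THEN conjunct2, THEN conjunct2, THEN conjunct1] u i by blast
  then show ?thesis
    unfolding ends using ne u v \<chi>
    by (simp add: cellimg_eq one chr_shift_Gdual eps_low_def eps_up_def)
qed

text \<open>An incidence function can only exist if no diagonal entry of \<open>G\<close> is trivial: otherwise both
  ends of an edge coincide and their incidences cannot cancel.\<close>

lemma chr_shift_single_ne:
  assumes "\<chi> \<in> Gdual G" "i < n" shows "chr_shift G \<chi> {#i#} \<noteq> \<chi>"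
  using eps_edge[OF assms] eps_low_unit[OF assms(1), of "{i}" i] assms(2)
  by (auto simp: eps_low_def eps_up_def)

text \<open>The pair of lifts chosen by \<open>SOME\<close> is pinned down as far as the geometry
  alone allows; which alternative for \<open>w\<close> holds is decided by the degrees in the next
  two lemmas.\<close>

lemma face_lifts_cell_of:
  assumes \<chi>: "\<chi> \<in> Gdual G" and S: "S \<subseteq> {..<n}" and i: "i \<in> S"
    and \<psi>: "\<psi> = \<chi> \<or> \<psi> = chr_shift G \<chi> {#i#}"
  obtains u w where "face_lifts n G (cell_of \<psi> (S - {i})) (cell_of \<chi> S) = (w, S - {i}, u, S)"
    "degZ n G u = \<chi>" "degZ n G w = \<psi>" "w = u \<or> w = vplus u (ind {i})"
proof -
  let ?\<eta> = "cell_of \<psi> (S - {i})"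
  have fin: "finite S" using S finite_subset by blast
  have \<psi>G: "\<psi> \<in> Gdual G" using \<psi> \<chi> chr_shift_Gdual by blast
  have S': "S - {i} \<subseteq> {..<n}" using S by auto
  have "is_facet n G ?\<eta> (cell_of \<chi> S)"
    using is_facet_low[OF \<chi> S i] is_facet_up[OF \<chi> S i] \<psi> by blast
  moreover have "?\<eta> \<noteq> {}"
  proof -
    obtain v where "v \<in> Zn n" "degZ n G v = \<psi>" using degZ_surj[OF \<psi>G] by blast
    then have "(\<lambda>j. real_of_int (v j)) \<in> ?\<eta>" by (auto simp: cell_of_def mem_cube)
    then show ?thesis by blast
  qed
  ultimately have ex: "\<exists>x. case x of (w, T, u, S') \<Rightarrow> face_lift n G ?\<eta> (cell_of \<chi> S) w T u S'"
    unfolding is_facet_def by auto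
  obtain w T u U where eq: "face_lifts n G ?\<eta> (cell_of \<chi> S) = (w, T, u, U)"
    by (metis surj_pair)
  have "face_lift n G ?\<eta> (cell_of \<chi> S) w T u U"
    using someI_ex[OF ex] eq unfolding face_lifts_def by simp
  then have TU: "T = S - {i}" "U = S" and deg: "degZ n G u = \<chi>" "degZ n G w = \<psi>"
    and sub: "cube w (S - {i}) \<subseteq> cube u S"
    unfolding face_lift_def is_lift_cell_of[OF \<chi> S] is_lift_cell_of[OF \<psi>G S'] by blast+
  have "card (S - {i}) + 1 = card S" using fin i by (metis Suc_eq_plus1 card_Suc_Diff1)
  with sub obtain a where "a \<in> S" "S - {i} = S - {a}" "w = u \<or> w = vplus u (ind {a})"
    using facet_cube_iff[OF fin, of "S - {i}" w u] by blast
  moreover have "a = i" using calculation i by blast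
  ultimately show thesis using that eq TU deg by blast
qed

lemma derivatives_low:
  assumes \<chi>: "\<chi> \<in> Gdual G" and S: "S \<subseteq> {..<n}" and i: "i \<in> S"
  shows "lder n G (cell_of \<chi> (S - {i})) (cell_of \<chi> S) = (chr_shift G \<chi> (mset_set (S - {i})), [i])"
    and "rder n G (cell_of \<chi> (S - {i})) (cell_of \<chi> S) = (\<chi>, [])"
proof -
  have "i < n" using i S by auto
  obtain u w where fl: "face_lifts n G (cell_of \<chi> (S - {i})) (cell_of \<chi> S) = (w, S - {i}, u, S)"
    and deg: "degZ n G u = \<chi>" "degZ n G w = \<chi>" and w: "w = u \<or> w = vplus u (ind {i})"
    using face_lifts_cell_of[OF \<chi> S i, of \<chi>] by blast
  \<comment> \<open>The far side would give \<open>w\<close> the degree of \<open>\<chi>\<close>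
    shifted by \<open>i\<close>, which differs from \<open>\<chi>\<close>.\<close>
  have wu: "w = u"
    using w deg chr_shift_single_ne[OF \<chi> \<open>i < n\<close>] degZ_unit[OF \<open>i < n\<close>, of u] by auto
  have "(\<lambda>k. u k + ind S k - (u k + ind (S - {i}) k)) = ind {i}"
    using i by (auto simp: ind_def fun_eq_iff)
  moreover have "S - {i} \<subseteq> {..<n}" using S by auto
  ultimately show "lder n G (cell_of \<chi> (S - {i})) (cell_of \<chi> S) = (chr_shift G \<chi> (mset_set (S - {i})), [i])"
    "rder n G (cell_of \<chi> (S - {i})) (cell_of \<chi> S) = (\<chi>, [])"
    by (simp_all add: lder_def rder_def fl wu deg degZ_ind labels_of_unit \<open>i < n\<close> labels_of_zero)
qed

lemma derivatives_up:
  assumes \<chi>: "\<chi> \<in> Gdual G" and S: "S \<subseteq> {..<n}" and i: "i \<in> S"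
  defines "\<psi> \<equiv> chr_shift G \<chi> {#i#}"
  shows "lder n G (cell_of \<psi> (S - {i})) (cell_of \<chi> S) = (chr_shift G \<chi> (mset_set S), [])"
    and "rder n G (cell_of \<psi> (S - {i})) (cell_of \<chi> S) = (\<chi>, [i])"
proof -
  have "i < n" using i S by auto
  have fin: "finite S" using S finite_subset by blast
  obtain u w where fl: "face_lifts n G (cell_of \<psi> (S - {i})) (cell_of \<chi> S) = (w, S - {i}, u, S)"
    and deg: "degZ n G u = \<chi>" "degZ n G w = \<psi>" and w: "w = u \<or> w = vplus u (ind {i})"
    using face_lifts_cell_of[OF \<chi> S i, of \<psi>] unfolding \<psi>_def by blast
  have wu: "w = vplus u (ind {i})"
    using w deg chr_shift_single_ne[OF \<chi> \<open>i < n\<close>] unfolding \<psi>_def by auto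
  have "(\<lambda>k. u k + ind S k - (w k + ind (S - {i}) k)) = (\<lambda>_. 0)"
    using i by (auto simp: wu ind_def vplus_def fun_eq_iff)
  moreover have "(\<lambda>k. w k - u k) = ind {i}" by (simp add: wu vplus_def)
  moreover have "S - {i} \<subseteq> {..<n}" using S by auto
  moreover have "chr_shift G \<psi> (mset_set (S - {i})) = chr_shift G \<chi> (mset_set S)"
    by (simp add: \<psi>_def chr_shift_union mset_set_remove1[OF fin i])
  ultimately show "lder n G (cell_of \<psi> (S - {i})) (cell_of \<chi> S) = (chr_shift G \<chi> (mset_set S), [])"
    "rder n G (cell_of \<psi> (S - {i})) (cell_of \<chi> S) = (\<chi>, [i])"
    by (simp_all add: lder_def rder_def fl deg degZ_ind labels_of_unit \<open>i < n\<close> labels_of_zero)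
qed

end

section \<open>Basis classes of the bimodules\<close>

lemma tens_delta: "tens (delta p) \<eta> (delta q) = delta (p, \<eta>, q)"
  by (auto simp: tens_def delta_def fun_eq_iff)

lemma tens_eq_lin_left:
  fixes a :: "'k::field path \<Rightarrow> 'k"
  shows "a \<in> fsupp UNIV \<Longrightarrow> tens a \<eta> (delta q) = lin (\<lambda>p. delta (p, \<eta>, q)) a"
proof
  fix t :: "'k tens" assume a: "a \<in> fsupp UNIV"
  obtain p \<eta>' q' where t: "t = (p, \<eta>', q')" by (cases t)
  have "lin (\<lambda>p. delta (p, \<eta>, q)) a t = (\<Sum>r\<in>insert p {r. a r \<noteq> 0}. a r * delta (r, \<eta>, q) t)"
    by (rule lin_eq_sum) (use a in \<open>auto simp: fsupp_def\<close>)
  also have "\<dots> = (\<Sum>r\<in>{p}. a r * delta (r, \<eta>, q) t)"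
    by (rule sum.mono_neutral_right) (use a t in \<open>auto simp: fsupp_def delta_def\<close>)
  finally show "tens a \<eta> (delta q) t = lin (\<lambda>p. delta (p, \<eta>, q)) a t"
    by (simp add: t tens_def delta_def)
qed

lemma tens_eq_lin_right:
  fixes a :: "'k::field path \<Rightarrow> 'k"
  shows "a \<in> fsupp UNIV \<Longrightarrow> tens (delta p) \<eta> a = lin (\<lambda>q. delta (p, \<eta>, q)) a"
proof
  fix t :: "'k tens" assume a: "a \<in> fsupp UNIV"
  obtain p' \<eta>' q where t: "t = (p', \<eta>', q)" by (cases t)
  have "lin (\<lambda>q. delta (p, \<eta>, q)) a t = (\<Sum>r\<in>insert q {r. a r \<noteq> 0}. a r * delta (p, \<eta>, r) t)"
    by (rule lin_eq_sum) (use a in \<open>auto simp: fsupp_def\<close>)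
  also have "\<dots> = (\<Sum>r\<in>{q}. a r * delta (p, \<eta>, r) t)"
    by (rule sum.mono_neutral_right) (use a t in \<open>auto simp: fsupp_def delta_def\<close>)
  finally show "tens (delta p) \<eta> a t = lin (\<lambda>q. delta (p, \<eta>, q)) a t"
    by (simp add: t tens_def delta_def)
qed

text \<open>The tail of the cell and that of the left factor are omitted, since in \<open>Tk\<close>
  they follow from the tail of the right factor, its labels and the directions.\<close>

definition tens_class :: "'k tens \<Rightarrow> 'k chr \<times> nat set \<times> nat multiset \<times> nat multiset" where
  "tens_class t = (case t of (p, \<eta>, q) \<Rightarrow> (fst q, cell_dirs \<eta>, mset (snd p), mset (snd q)))"

context diag_group
begin

definition classes :: "nat \<Rightarrow> ('k chr \<times> nat set \<times> nat multiset \<times> nat multiset) set" where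
  "classes k = {(\<omega>, S, A, B). \<omega> \<in> Gdual G \<and> S \<subseteq> {..<n} \<and> card S = k \<and>
     set_mset A \<subseteq> {..<n} \<and> set_mset B \<subseteq> {..<n}}"

definition class_rep :: "'k chr \<times> nat set \<times> nat multiset \<times> nat multiset \<Rightarrow> 'k tens" where
  "class_rep c = (case c of (\<omega>, S, A, B) \<Rightarrow>
     (sorted_path (chr_shift G (chr_shift G \<omega> B) (mset_set S), A), cell_of (chr_shift G \<omega> B) S,
      sorted_path (\<omega>, B)))"

lemma Tk_iff: "t \<in> Tk n G k \<longleftrightarrow> (\<exists>\<chi> S a \<omega> b. t = ((chr_shift G \<chi> (mset_set S), a), cell_of \<chi> S, (\<omega>, b)) \<and>
    \<omega> \<in> Gdual G \<and> S \<subseteq> {..<n} \<and> card S = k \<and> set a \<subseteq> {..<n} \<and> set b \<subseteq> {..<n} \<and>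
    \<chi> = chr_shift G \<omega> (mset b))"
proof
  assume "t \<in> Tk n G k"
  then obtain p \<eta> q where t: "t = (p, \<eta>, q)" and \<eta>: "\<eta> \<in> Delta_k n G k"
    and v: "valid_path n G p" "valid_path n G q"
    and h: "fst p = cell_head n G \<eta>" "path_head G q = cell_tail n G \<eta>"
    by (auto simp: Tk_def)
  from \<eta> obtain \<chi> S where S: "\<chi> \<in> Gdual G" "S \<subseteq> {..<n}" "card S = k" "\<eta> = cell_of \<chi> S"
    by (auto simp: Delta_k_eq)
  then show "\<exists>\<chi> S a \<omega> b. t = ((chr_shift G \<chi> (mset_set S), a), cell_of \<chi> S, (\<omega>, b)) \<and>
    \<omega> \<in> Gdual G \<and> S \<subseteq> {..<n} \<and> card S = k \<and> set a \<subseteq> {..<n} \<and> set b \<subseteq> {..<n} \<and>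
    \<chi> = chr_shift G \<omega> (mset b)"
    using t v h
    by (intro exI[of _ \<chi>] exI[of _ S] exI[of _ "snd p"] exI[of _ "fst q"] exI[of _ "snd q"])
      (simp_all add: valid_path_def cell_head_cell_of cell_tail_cell_of prod_eq_iff path_head_class path_class_def)
next
  assume "\<exists>\<chi> S a \<omega> b. t = ((chr_shift G \<chi> (mset_set S), a), cell_of \<chi> S, (\<omega>, b)) \<and>
    \<omega> \<in> Gdual G \<and> S \<subseteq> {..<n} \<and> card S = k \<and> set a \<subseteq> {..<n} \<and> set b \<subseteq> {..<n} \<and>
    \<chi> = chr_shift G \<omega> (mset b)"
  then obtain \<chi> S a \<omega> b where *: "t = ((chr_shift G \<chi> (mset_set S), a), cell_of \<chi> S, (\<omega>, b))"
    "\<omega> \<in> Gdual G" "S \<subseteq> {..<n}" "card S = k" "set a \<subseteq> {..<n}" "set b \<subseteq> {..<n}"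
    "\<chi> = chr_shift G \<omega> (mset b)" by blast
  have \<chi>: "\<chi> \<in> Gdual G" using * chr_shift_Gdual by blast
  then have "cell_of \<chi> S \<in> Delta_k n G k" unfolding Delta_k_eq using * by blast
  then show "t \<in> Tk n G k"
    using * \<chi> chr_shift_Gdual[OF \<chi>]
    by (simp add: Tk_def valid_path_def cell_head_cell_of cell_tail_cell_of path_head_eq)
qed

lemma TkI:
  assumes "\<omega> \<in> Gdual G" "S \<subseteq> {..<n}" "card S = k" "set a \<subseteq> {..<n}" "set b \<subseteq> {..<n}"
    and "\<chi> = chr_shift G \<omega> (mset b)" "\<psi> = chr_shift G \<chi> (mset_set S)"
  shows "((\<psi>, a), cell_of \<chi> S, (\<omega>, b)) \<in> Tk n G k"
  unfolding Tk_iff using assms by blast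

lemma tens_class_classes: "t \<in> Tk n G k \<Longrightarrow> tens_class t \<in> classes k"
  unfolding Tk_iff by (auto simp: tens_class_def classes_def cell_dirs_cell_of chr_shift_Gdual)

lemma class_rep_Tk: "c \<in> classes k \<Longrightarrow> class_rep c \<in> Tk n G k"
  unfolding Tk_iff by (auto simp: classes_def class_rep_def sorted_path_def)

lemma tens_class_rep: "c \<in> classes k \<Longrightarrow> tens_class (class_rep c) = c"
  by (auto simp: classes_def class_rep_def sorted_path_def tens_class_def cell_dirs_cell_of chr_shift_Gdual)

lemma class_rep_tens_class:
  "(p, \<eta>, q) \<in> Tk n G k \<Longrightarrow>
    class_rep (tens_class (p, \<eta>, q)) = (sorted_path (path_class p), \<eta>, sorted_path (path_class q))"
  unfolding Tk_iff
  by (auto simp: tens_class_def class_rep_def path_class_def sorted_path_def cell_dirs_cell_of chr_shift_Gdual)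

lemma Nsub_Pmod_class_zero:
  "x \<in> Nsub n G k \<Longrightarrow> x \<in> Pmod n G k \<and> lin (\<lambda>t. delta (tens_class t)) x = (\<lambda>_. 0 :: 'k)"
  unfolding Pmod_eq_fsupp
proof (induction rule: Nsub.induct)
  case zero
  then show ?case by (simp add: lin_zero fsupp_zero)
next
  case (add x y)
  then show ?case 
    by (simp add: lin_add[OF fsupp_UNIV[of x "Tk n G k"] fsupp_UNIV[of y "Tk n G k"]] fsupp_add)
next
  case (smul x c)
  then show ?case 
    by (simp add: lin_smul[OF fsupp_UNIV[of x "Tk n G k"]] fsupp_smul)
next
  case (left j \<eta> q)
  have j: "j \<in> fsupp {p. valid_path n G p \<and> fst p = cell_head n G \<eta>}"
    using Jideal_kQ[OF left(1)] left(3) by (auto simp: kQ_def fsupp_def)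
  have t: "tens j \<eta> (pvec q) = lin (\<lambda>p. delta (p, \<eta>, q)) j"
    unfolding pvec_eq_delta by (rule tens_eq_lin_left[OF fsupp_UNIV[OF j]])
  have "lin (\<lambda>t. delta (tens_class t)) (tens j \<eta> (pvec q)) = lin (\<lambda>p. delta (tens_class (p, \<eta>, q))) j"
    unfolding t by (subst lin_lin[OF j]) (auto simp: lin_delta fsupp_delta)
  also have "\<dots> = lin (\<lambda>c. delta (fst q, cell_dirs \<eta>, snd c, mset (snd q)))
      (lin (\<lambda>p. delta (path_class p)) j)"
    by (rule lin_class_factor[OF j]) (simp add: tens_class_def path_class_def)
  finally have "lin (\<lambda>t. delta (tens_class t)) (tens j \<eta> (pvec q)) = (\<lambda>_. 0)"
    by (simp add: Jideal_class_zero[OF left(1)] lin_zero)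
  moreover have "tens j \<eta> (pvec q) \<in> fsupp (Tk n G k)"
    unfolding t by (rule lin_fsupp[OF j]) (use left in \<open>auto intro!: fsupp_delta simp: Tk_def\<close>)
  ultimately show ?case by blast
next
  case (right j \<eta> p)
  have j: "j \<in> fsupp {q. valid_path n G q \<and> path_head G q = cell_tail n G \<eta>}"
    using Jideal_kQ[OF right(1)] right(3) by (auto simp: kQ_def fsupp_def)
  have t: "tens (pvec p) \<eta> j = lin (\<lambda>q. delta (p, \<eta>, q)) j"
    unfolding pvec_eq_delta by (rule tens_eq_lin_right[OF fsupp_UNIV[OF j]])
  have "lin (\<lambda>t. delta (tens_class t)) (tens (pvec p) \<eta> j) = lin (\<lambda>q. delta (tens_class (p, \<eta>, q))) j"
    unfolding t by (subst lin_lin[OF j]) (auto simp: lin_delta fsupp_delta)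
  also have "\<dots> = lin (\<lambda>c. delta (fst c, cell_dirs \<eta>, mset (snd p), snd c))
      (lin (\<lambda>p. delta (path_class p)) j)"
    by (rule lin_class_factor[OF j]) (simp add: tens_class_def path_class_def)
  finally have "lin (\<lambda>t. delta (tens_class t)) (tens (pvec p) \<eta> j) = (\<lambda>_. 0)"
    by (simp add: Jideal_class_zero[OF right(1)] lin_zero)
  moreover have "tens (pvec p) \<eta> j \<in> fsupp (Tk n G k)"
    unfolding t by (rule lin_fsupp[OF j]) (use right in \<open>auto intro!: fsupp_delta simp: Tk_def\<close>)
  ultimately show ?case by blast
qed

lemma Nsub_sum: "(\<And>i. i \<in> I \<Longrightarrow> f i \<in> Nsub n G k) \<Longrightarrow> (\<lambda>t. \<Sum>i\<in>I. f i t) \<in> Nsub n G k"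
  by (induction I rule: infinite_finite_induct) (auto intro: Nsub.zero Nsub.add)

text \<open>The two factors are sorted one after the other, the left by a \<open>left\<close>
  generator of \<open>Nsub\<close> and the right by a \<open>right\<close> generator.\<close>

lemma Nsub_class_rep:
  assumes "t \<in> Tk n G k"
  shows "(\<lambda>s. delta t s - delta (class_rep (tens_class t)) s) \<in> Nsub n G k"
proof -
  obtain p \<eta> q where t: "t = (p, \<eta>, q)" by (cases t)
  let ?p = "sorted_path (path_class p)" and ?q = "sorted_path (path_class q)"
  from assms have Tk: "(p, \<eta>, q) \<in> Tk n G k" unfolding t .
  then have \<eta>: "\<eta> \<in> Delta_k n G k" and v: "valid_path n G p" "valid_path n G q"
    and h: "fst p = cell_head n G \<eta>" "path_head G q = cell_tail n G \<eta>"
    by (auto simp: Tk_def)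
  have v': "valid_path n G ?p" "fst ?p = fst p" "path_head G ?q = path_head G q"
    using v by (auto simp: valid_path_def sorted_path_def path_class_def path_head_class)
  have "tens (\<lambda>r. delta p r - delta ?p r) \<eta> (pvec q) \<in> Nsub n G k"
    by (rule Nsub.left[OF Jcong_sorted[OF v(1)] \<eta>])
      (use v' v h in \<open>auto simp: delta_def simp del: split_paired_All split: if_splits\<close>)
  moreover have "tens (\<lambda>r. delta p r - delta ?p r) \<eta> (pvec q) =
      (\<lambda>s. delta (p, \<eta>, q) s - delta (?p, \<eta>, q) s :: 'k)"
    by (auto simp: tens_def delta_def pvec_def fun_eq_iff)
  ultimately have N1: "(\<lambda>s. delta (p, \<eta>, q) s - delta (?p, \<eta>, q) s) \<in> Nsub n G k" by simp
  have "tens (pvec ?p) \<eta> (\<lambda>r. delta q r - delta ?q r) \<in> Nsub n G k"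
    by (rule Nsub.right[OF Jcong_sorted[OF v(2)] \<eta>])
      (use v' v h in \<open>auto simp: delta_def simp del: split_paired_All split: if_splits\<close>)
  moreover have "tens (pvec ?p) \<eta> (\<lambda>r. delta q r - delta ?q r) =
      (\<lambda>s. delta (?p, \<eta>, q) s - delta (?p, \<eta>, ?q) s :: 'k)"
    by (auto simp: tens_def delta_def pvec_def fun_eq_iff)
  ultimately have N2: "(\<lambda>s. delta (?p, \<eta>, q) s - delta (?p, \<eta>, ?q) s) \<in> Nsub n G k" by simp
  from Nsub.add[OF N1 N2] have "(\<lambda>s. delta (p, \<eta>, q) s - delta (?p, \<eta>, ?q) s) \<in> Nsub n G k" by simp
  then show ?thesis unfolding t class_rep_tens_class[OF Tk] by simp
qed

lemma Nsub_iff: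
  "x \<in> Nsub n G k \<longleftrightarrow> x \<in> Pmod n G k \<and> lin (\<lambda>t. delta (tens_class t)) x = (\<lambda>_. 0 :: 'k)"
proof
  assume *: "x \<in> Pmod n G k \<and> lin (\<lambda>t. delta (tens_class t)) x = (\<lambda>_. 0 :: 'k)"
  then have x: "x \<in> fsupp (Tk n G k)" by (simp add: Pmod_eq_fsupp)
  have "(\<lambda>s. lin delta x s - lin (\<lambda>t. delta (class_rep (tens_class t))) x s) \<in> Nsub n G k"
    unfolding lin_def sum_subtractf[symmetric] right_diff_distrib[symmetric]
    by (intro Nsub_sum Nsub.smul Nsub_class_rep) (use fsupp_mem[OF x] in auto)
  moreover have "lin (\<lambda>t. delta (class_rep (tens_class t))) x =
      lin (\<lambda>c. delta (class_rep c)) (lin (\<lambda>t. delta (tens_class t)) x)"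
    by (rule lin_class_factor[OF x]) auto
  ultimately show "x \<in> Nsub n G k"
    using * by (simp add: lin_zero lin_delta_id[OF x])
qed (rule Nsub_Pmod_class_zero)

end

section \<open>The differential on basis classes\<close>

context incidence
begin

text \<open>The cellular boundary of the face \<open>B + [0,1]^S\<close>: the near facet keeps the
  corner \<open>B\<close> and its left derivative adds \<open>i\<close> to \<open>A\<close>; the far
  facet moves the corner and its right derivative adds \<open>i\<close> to \<open>B\<close>.\<close>

definition class_bd ::
    "'k chr \<times> nat set \<times> nat multiset \<times> nat multiset \<Rightarrow>
     'k chr \<times> nat set \<times> nat multiset \<times> nat multiset \<Rightarrow> 'k" where
  "class_bd c = (case c of (\<omega>, S, A, B) \<Rightarrow> (\<lambda>s. \<Sum>i\<in>S.
     of_int (eps_low (chr_shift G \<omega> B) S i) * delta (\<omega>, S - {i}, add_mset i A, B) s +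
     of_int (eps_up (chr_shift G \<omega> B) S i) * delta (\<omega>, S - {i}, A, add_mset i B) s))"

lemma dbasis_cell_of:
  assumes \<chi>: "\<chi> \<in> Gdual G" and S: "S \<subseteq> {..<n}" "S \<noteq> {}" and \<chi>b: "\<chi> = chr_shift G \<omega> (mset b)"
  shows "dbasis n G \<epsilon> ((chr_shift G \<chi> (mset_set S), a), cell_of \<chi> S, (\<omega>, b)) = (\<lambda>s. \<Sum>i\<in>S.
     of_int (eps_low \<chi> S i) *
       delta ((chr_shift G \<chi> (mset_set (S - {i})), i # a), cell_of \<chi> (S - {i}), (\<omega>, b)) s +
     of_int (eps_up \<chi> S i) *
       delta ((chr_shift G \<chi> (mset_set S), a), cell_of (chr_shift G \<chi> {#i#}) (S - {i}), (\<omega>, b @ [i])) s)"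
proof
  fix s
  let ?p = "(chr_shift G \<chi> (mset_set S), a)" and ?q = "(\<omega>, b)"
  let ?lo = "\<lambda>i. cell_of \<chi> (S - {i})" and ?up = "\<lambda>i. cell_of (chr_shift G \<chi> {#i#}) (S - {i})"
  let ?f = "\<lambda>\<eta>'. of_int (\<epsilon> (cell_of \<chi> S) \<eta>') *
        tens (kQmul G (pvec ?p) (pvec (lder n G \<eta>' (cell_of \<chi> S)))) \<eta>'
             (kQmul G (pvec (rder n G \<eta>' (cell_of \<chi> S))) (pvec ?q)) s"
  have fin: "finite S" using S finite_subset by blast
  have G1: "chr_shift G \<chi> {#i#} \<in> Gdual G" for i using chr_shift_Gdual[OF \<chi>] .
  have facets: "{\<eta>'. is_facet n G \<eta>' (cell_of \<chi> S)} = ?lo ` S \<union> ?up ` S"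
    using is_facet_cell_of[OF \<chi> S] by blast
  \<comment> \<open>A near facet can equal a far one only if shifting the tail by some
    \<open>j\<close> in \<open>S\<close> fixes it.\<close>
  have disj: "?lo ` S \<inter> ?up ` S = {}"
  proof -
    have "?lo i \<noteq> ?up j" if "i \<in> S" "j \<in> S" for i j
    proof -
      have "j < n" using that S by auto
      then show ?thesis using chr_shift_single_ne[OF \<chi>, of j] by (simp add: cell_of_eq_iff[OF \<chi> G1])
    qed
    then show ?thesis by blast
  qed
  have remove_inj: "i = j" if "i \<in> S" "j \<in> S" "S - {i} = S - {j}" for i j
    using that by blast
  have inj: "inj_on ?lo S"
    by (rule inj_onI, rule remove_inj) (simp_all add: cell_of_eq_iff[OF \<chi> \<chi>])
  have inj': "inj_on ?up S"
    by (rule inj_onI, rule remove_inj) (simp_all add: cell_of_eq_iff[OF G1 G1])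
  have "dbasis n G \<epsilon> (?p, cell_of \<chi> S, ?q) s = sum ?f (?lo ` S \<union> ?up ` S)"
    by (simp add: dbasis_def facets)
  also have "\<dots> = (\<Sum>i\<in>S. ?f (?lo i)) + (\<Sum>i\<in>S. ?f (?up i))"
    using fin by (subst sum.union_disjoint[OF _ _ disj]) (simp_all add: sum.reindex[OF inj] sum.reindex[OF inj'])
  also have "\<dots> = (\<Sum>i\<in>S. ?f (?lo i) + ?f (?up i))" by (simp add: sum.distrib)
  also have "\<dots> = (\<Sum>i\<in>S. of_int (eps_low \<chi> S i) *
       delta ((chr_shift G \<chi> (mset_set (S - {i})), i # a), ?lo i, ?q) s +
     of_int (eps_up \<chi> S i) * delta (?p, ?up i, (\<omega>, b @ [i])) s)"
  proof (rule sum.cong[OF refl])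
    fix i assume i: "i \<in> S"
    \<comment> \<open>The left derivative ends where the left factor begins, so the product in
      \<open>kQmul\<close> is a path and not zero.\<close>
    have "chr_shift G (chr_shift G \<chi> (mset_set (S - {i}))) {#i#} = chr_shift G \<chi> (mset_set S)"
      by (simp add: chr_shift_union mset_set_remove1[OF fin i])
    then show "?f (?lo i) + ?f (?up i) = of_int (eps_low \<chi> S i) *
       delta ((chr_shift G \<chi> (mset_set (S - {i})), i # a), ?lo i, ?q) s +
     of_int (eps_up \<chi> S i) * delta (?p, ?up i, (\<omega>, b @ [i])) s"
      unfolding derivatives_low[OF \<chi> S(1) i] derivatives_up[OF \<chi> S(1) i] pvec_eq_delta kQmul_delta_delta
      by (simp add: path_head_eq \<chi>b[symmetric] tens_delta pcomp_def eps_low_def eps_up_def)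
  qed
  finally show "dbasis n G \<epsilon> (?p, cell_of \<chi> S, ?q) s = \<dots>" .
qed

text \<open>Each term gains a label, at the start of the left factor or at the end of the right one.
  This is the source of minimality. The second part is the compatibility with classes.\<close>

lemma dbasis_in:
  assumes "t \<in> Tk n G (Suc k)"
  shows "dbasis n G \<epsilon> t \<in> fsupp {(p, \<eta>, q) \<in> Tk n G k. snd p \<noteq> [] \<or> snd q \<noteq> []}"
    and "lin (\<lambda>t. delta (tens_class t)) (dbasis n G \<epsilon> t) = class_bd (tens_class t)"
proof -
  from assms obtain \<chi> S a \<omega> b where t: "t = ((chr_shift G \<chi> (mset_set S), a), cell_of \<chi> S, (\<omega>, b))"
    and \<omega>: "\<omega> \<in> Gdual G" and S: "S \<subseteq> {..<n}" "card S = Suc k" and ab: "set a \<subseteq> {..<n}" "set b \<subseteq> {..<n}"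
    and \<chi>b: "\<chi> = chr_shift G \<omega> (mset b)"
    unfolding Tk_iff by blast
  have \<chi>: "\<chi> \<in> Gdual G" using \<omega> \<chi>b chr_shift_Gdual by blast
  have fin: "finite S" "S \<noteq> {}" using S finite_subset by auto
  let ?lo = "\<lambda>i. ((chr_shift G \<chi> (mset_set (S - {i})), i # a), cell_of \<chi> (S - {i}), (\<omega>, b))"
  let ?up = "\<lambda>i. ((chr_shift G \<chi> (mset_set S), a), cell_of (chr_shift G \<chi> {#i#}) (S - {i}), (\<omega>, b @ [i]))"
  have d: "dbasis n G \<epsilon> t = (\<lambda>s. \<Sum>i\<in>S. of_int (eps_low \<chi> S i) * delta (?lo i) s +
     of_int (eps_up \<chi> S i) * delta (?up i) s)"
    unfolding t by (rule dbasis_cell_of[OF \<chi> S(1) fin(2) \<chi>b])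
  have "?lo i \<in> Tk n G k" if i: "i \<in> S" for i
    by (rule TkI) (use S ab \<omega> \<chi>b i in auto)
  moreover have "?up i \<in> Tk n G k" if i: "i \<in> S" for i
    by (rule TkI) (use S ab \<omega> i in
      \<open>auto simp: \<chi>b chr_shift_union mset_set_remove1[OF fin(1) i, symmetric]\<close>)
  ultimately show "dbasis n G \<epsilon> t \<in> fsupp {(p, \<eta>, q) \<in> Tk n G k. snd p \<noteq> [] \<or> snd q \<noteq> []}"
    unfolding d by (intro fsupp_sum fsupp_add fsupp_smul fsupp_delta) auto
  have "lin (\<lambda>t. delta (tens_class t)) (dbasis n G \<epsilon> t) =
    (\<lambda>s. \<Sum>i\<in>S. of_int (eps_low \<chi> S i) * delta (tens_class (?lo i)) s +
     of_int (eps_up \<chi> S i) * delta (tens_class (?up i)) s)"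
    unfolding d by (simp add: lin_sum lin_add lin_smul lin_delta fsupp_add fsupp_smul fsupp_delta)
  also have "\<dots> = class_bd (tens_class t)"
    using \<chi> \<chi>b by (simp add: t class_bd_def tens_class_def cell_dirs_cell_of chr_shift_Gdual)
  finally show "lin (\<lambda>t. delta (tens_class t)) (dbasis n G \<epsilon> t) = class_bd (tens_class t)" .
qed

lemma class_bd_fsupp:
  assumes "c \<in> classes (Suc k)" shows "class_bd c \<in> fsupp (classes k)"
proof -
  obtain \<omega> S A B where c: "c = (\<omega>, S, A, B)" by (cases c)
  have "(\<omega>, S - {i}, add_mset i A, B) \<in> classes k" "(\<omega>, S - {i}, A, add_mset i B) \<in> classes k" if "i \<in> S" for i
    using assms that by (auto simp: c classes_def)
  then show ?thesis unfolding class_bd_def c prod.case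
    by (intro fsupp_sum fsupp_add fsupp_smul fsupp_delta)
qed

lemma class_bd_bd:
  assumes "c \<in> classes k" shows "lin class_bd (class_bd c) = (\<lambda>_. 0)"
proof
  fix s
  obtain \<omega> S A B where c: "c = (\<omega>, S, A, B)" by (cases c)
  have \<omega>: "\<omega> \<in> Gdual G" and S: "S \<subseteq> {..<n}" using assms by (auto simp: c classes_def)
  have fin: "finite S" using S finite_subset by blast
  define \<chi> where "\<chi> = chr_shift G \<omega> B"
  have \<chi>: "\<chi> \<in> Gdual G" using \<omega> chr_shift_Gdual by (simp add: \<chi>_def)
  \<comment> \<open>The first letter records the side of the facet removed first, the second that of
    the next. On swapping \<open>i\<close> and \<open>j\<close>, \<open>LL\<close> and
    \<open>UU\<close> cancel against themselves and \<open>LU\<close> against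
    \<open>UL\<close>.\<close>
  define LL where "LL i j = (of_int (eps_low \<chi> S i * eps_low \<chi> (S - {i}) j) *
      delta (\<omega>, S - {i} - {j}, add_mset j (add_mset i A), B) s :: 'k)" for i j
  define LU where "LU i j = (of_int (eps_low \<chi> S i * eps_up \<chi> (S - {i}) j) *
      delta (\<omega>, S - {i} - {j}, add_mset i A, add_mset j B) s :: 'k)" for i j
  define UL where "UL i j = (of_int (eps_up \<chi> S i * eps_low (chr_shift G \<chi> {#i#}) (S - {i}) j) *
      delta (\<omega>, S - {i} - {j}, add_mset j A, add_mset i B) s :: 'k)" for i j
  define UU where "UU i j = (of_int (eps_up \<chi> S i * eps_up (chr_shift G \<chi> {#i#}) (S - {i}) j) *
      delta (\<omega>, S - {i} - {j}, A, add_mset j (add_mset i B)) s :: 'k)" for i j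
  have \<chi>i: "chr_shift G \<omega> (add_mset i B) = chr_shift G \<chi> {#i#}" for i
    by (simp add: \<chi>_def chr_shift_union)
  have bd: "class_bd (\<omega>, S, A, B) = (\<lambda>s. \<Sum>i\<in>S.
      of_int (eps_low \<chi> S i) * delta (\<omega>, S - {i}, add_mset i A, B) s +
      of_int (eps_up \<chi> S i) * delta (\<omega>, S - {i}, A, add_mset i B) s)"
    by (simp add: class_bd_def \<chi>_def)
  have "lin class_bd (class_bd c) s = (\<Sum>i\<in>S.
      of_int (eps_low \<chi> S i) * class_bd (\<omega>, S - {i}, add_mset i A, B) s +
      of_int (eps_up \<chi> S i) * class_bd (\<omega>, S - {i}, A, add_mset i B) s)"
    unfolding c bd
    by (simp add: lin_sum lin_add lin_smul lin_delta fsupp_add fsupp_smul fsupp_delta)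
  also have "\<dots> = (\<Sum>i\<in>S. \<Sum>j\<in>S - {i}. LL i j + LU i j + UL i j + UU i j)"
    unfolding class_bd_def prod.case \<chi>_def[symmetric] \<chi>i LL_def LU_def UL_def UU_def
    by (simp add: sum_distrib_left sum.distrib algebra_simps)
  also have "\<dots> = 0"
  proof (rule sum_antisym_zero[OF fin])
    fix i j assume ij: "i \<in> S" "j \<in> S" "i \<noteq> j"
    have sw: "S - {j} - {i} = S - {i} - {j}" by blast
    have "LL i j + LL j i = of_int (eps_low \<chi> S i * eps_low \<chi> (S - {i}) j + eps_low \<chi> S j * eps_low \<chi> (S - {j}) i) *
      delta (\<omega>, S - {i} - {j}, add_mset j (add_mset i A), B) s"
      unfolding LL_def sw by (simp add: algebra_simps add_mset_commute)
    moreover have "LU i j + UL j i = of_int (eps_low \<chi> S i * eps_up \<chi> (S - {i}) j +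
        eps_up \<chi> S j * eps_low (chr_shift G \<chi> {#j#}) (S - {j}) i) *
      delta (\<omega>, S - {i} - {j}, add_mset i A, add_mset j B) s" if "i \<in> S" "j \<in> S" for i j
    proof -
      have sw: "S - {j} - {i} = S - {i} - {j}" by blast
      show ?thesis unfolding LU_def UL_def sw by (simp add: algebra_simps)
    qed
    note this[OF ij(1,2)] this[OF ij(2,1)]
    moreover have "UU i j + UU j i = of_int (eps_up \<chi> S i * eps_up (chr_shift G \<chi> {#i#}) (S - {i}) j +
        eps_up \<chi> S j * eps_up (chr_shift G \<chi> {#j#}) (S - {j}) i) *
      delta (\<omega>, S - {i} - {j}, A, add_mset j (add_mset i B)) s"
      unfolding UU_def sw by (simp add: algebra_simps add_mset_commute)
    ultimately have "LL i j + LL j i = 0" "LU i j + UL j i = 0" "LU j i + UL i j = 0" "UU i j + UU j i = 0"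
      using eps_low_low[OF \<chi> S ij] eps_low_up[OF \<chi> S ij] eps_low_up[OF \<chi> S ij(2,1) ij(3)[symmetric]]
        eps_up_up[OF \<chi> S ij] by simp_all
    moreover have "LL i j + LU i j + UL i j + UU i j + (LL j i + LU j i + UL j i + UU j i) =
      (LL i j + LL j i) + (LU i j + UL j i) + (LU j i + UL i j) + (UU i j + UU j i)"
      by (simp add: algebra_simps)
    ultimately show "LL i j + LU i j + UL i j + UU i j + (LL j i + LU j i + UL j i + UU j i) = 0" by simp
  qed
  finally show "lin class_bd (class_bd c) s = 0" .
qed

end

section \<open>Exactness by an acyclic matching\<close>

context incidence
begin

text \<open>Classes with fixed \<open>\<omega>\<close> and \<open>A + S + B\<close> are the faces \<open>B + [0,1]\<^sup>S\<close> of a box. The discrete Morse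
  matching contracting this box to its corner \<open>B = S = 0\<close> moves along the first coordinate \<open>i\<close> in
  which the face leaves the corner; \<open>upward\<close> consists of the faces that are the far \<open>i\<close>-facet
  of their partner.\<close>

definition upward :: "('k chr \<times> nat set \<times> nat multiset \<times> nat multiset) set" where
  "upward = {(\<omega>, S, A, B). \<exists>i. i \<in># B \<and> i \<notin> S \<and> (\<forall>j<i. j \<notin> S \<and> j \<notin># B)}"

text \<open>The measure that makes elimination along the matching terminate: near facets of the
  partner of an \<open>upward\<close> class have one label fewer in \<open>B\<close>.\<close>

definition class_size :: "'k chr \<times> nat set \<times> nat multiset \<times> nat multiset \<Rightarrow> nat" where
  "class_size c = (case c of (\<omega>, S, A, B) \<Rightarrow> size B)"

lemma of_int_sign_square: "e \<in> {-1, 1} \<Longrightarrow> of_int e * of_int e = (1 :: 'k)"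
  by auto

text \<open>The partner of \<open>c\<close> moves \<open>i\<close> from \<open>B\<close> into the
  directions. Its far \<open>i\<close>-facet is \<open>c\<close>, its near \<open>i\<close>-facet
  has smaller \<open>B\<close>, and the other facets keep the first direction \<open>i\<close> and
  so are not in \<open>upward\<close>.\<close>

lemma upward_lead:
  assumes c: "c \<in> classes k" and up: "c \<in> upward"
  shows "\<exists>y\<in>fsupp (classes (Suc k)). (\<lambda>t. delta c t - lin class_bd y t) \<in>
    fsupp {c' \<in> classes k. c' \<notin> upward \<or> class_size c' < class_size c}"
proof -
  obtain \<omega> S A B i where cc: "c = (\<omega>, S, A, B)" and i: "i \<in># B" "i \<notin> S"
    and min: "\<And>j. j < i \<Longrightarrow> j \<notin> S \<and> j \<notin># B"
    using up unfolding upward_def by auto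
  obtain B' where B: "B = add_mset i B'" using i(1) by (metis insert_DiffM)
  have V: "\<omega> \<in> Gdual G" "S \<subseteq> {..<n}" "card S = k" "set_mset A \<subseteq> {..<n}" "set_mset B' \<subseteq> {..<n}" "i < n"
    using c by (auto simp: cc B classes_def)
  have fin: "finite S" using V finite_subset by blast
  define \<chi> where "\<chi> = chr_shift G \<omega> B'"
  have \<chi>: "\<chi> \<in> Gdual G" using V chr_shift_Gdual by (simp add: \<chi>_def)
  let ?S = "insert i S"
  let ?e = "of_int (eps_up \<chi> ?S i) :: 'k"
  let ?R = "{c' \<in> classes k. c' \<notin> upward \<or> class_size c' < class_size c}"
  \<comment> \<open>The sign is its own inverse, so \<open>?e\<close> times the partner has boundary
    coefficient 1 at \<open>c\<close>.\<close>
  have ee: "?e * ?e = 1" using V \<chi> by (intro of_int_sign_square eps_up_unit) auto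
  define r where "r = (\<lambda>t. \<Sum>j\<in>S. of_int (eps_low \<chi> ?S j) * delta (\<omega>, ?S - {j}, add_mset j A, B') t +
     of_int (eps_up \<chi> ?S j) * delta (\<omega>, ?S - {j}, A, add_mset j B') t :: 'k)"
  have bd: "class_bd (\<omega>, ?S, A, B') t = of_int (eps_low \<chi> ?S i) * delta (\<omega>, S, add_mset i A, B') t +
      ?e * delta c t + r t" for t
    using i fin by (simp add: class_bd_def \<chi>_def r_def cc B)
  have "r \<in> fsupp ?R"
    unfolding r_def
  proof (intro fsupp_sum fsupp_add fsupp_smul fsupp_delta)
    fix j assume j: "j \<in> S"
    have ji: "i < j" using min j i by (metis linorder_neqE_nat)
    have cl: "(\<omega>, ?S - {j}, add_mset j A, B') \<in> classes k" "(\<omega>, ?S - {j}, A, add_mset j B') \<in> classes k"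
      using V j i fin by (auto simp: classes_def card_insert_if)
    \<comment> \<open>A witness \<open>a\<close> for \<open>upward\<close> would lie below the
      direction \<open>i\<close>; but \<open>B\<close> has no label below \<open>i\<close>, and the
      added label \<open>j\<close> is above it.\<close>
    have nu: "(\<omega>, ?S - {j}, A', B'') \<notin> upward" if "set_mset B'' \<subseteq> insert j (set_mset B)" for A' B''
    proof
      assume "(\<omega>, ?S - {j}, A', B'') \<in> upward"
      then obtain a where a: "a \<in># B''" "a \<notin> ?S - {j}" "\<forall>b<a. b \<notin> ?S - {j}"
        by (auto simp: upward_def)
      have "i \<in> ?S - {j}" using ji by simp
      then have "a < i" using a(2,3) by (metis linorder_neqE_nat)
      then show False using min[of a] a(1) that ji by auto
    qed
    show "(\<omega>, ?S - {j}, add_mset j A, B') \<in> ?R" "(\<omega>, ?S - {j}, A, add_mset j B') \<in> ?R"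
      using cl nu[of B' "add_mset j A"] nu[of "add_mset j B'" A] by (auto simp: B)
  qed
  moreover have "(\<omega>, S, add_mset i A, B') \<in> ?R"
    using V by (simp add: classes_def class_size_def cc B)
  ultimately have "(\<lambda>t. - (?e * of_int (eps_low \<chi> ?S i)) * delta (\<omega>, S, add_mset i A, B') t + - ?e * r t) \<in> fsupp ?R"
    by (intro fsupp_add fsupp_smul fsupp_delta)
  also have "(\<lambda>t. - (?e * of_int (eps_low \<chi> ?S i)) * delta (\<omega>, S, add_mset i A, B') t + - ?e * r t) =
      (\<lambda>t. delta c t - lin class_bd (\<lambda>t. ?e * delta (\<omega>, ?S, A, B') t) t)"
  proof
    fix t
    have "?e * (?e * delta c t) = delta c t" using ee by (simp add: mult.assoc[symmetric])
    then show "- (?e * of_int (eps_low \<chi> ?S i)) * delta (\<omega>, S, add_mset i A, B') t + - ?e * r t =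
      delta c t - lin class_bd (\<lambda>t. ?e * delta (\<omega>, ?S, A, B') t) t"
      by (simp add: lin_smul[OF fsupp_delta] lin_delta bd distrib_left mult.assoc)
  qed
  finally show ?thesis
    by (rule bexI[of _ "\<lambda>t. ?e * delta (\<omega>, ?S, A, B') t"]) (use V i fin in \<open>auto intro!: fsupp_smul fsupp_delta simp: classes_def\<close>)
qed

text \<open>Otherwise the least label of \<open>B\<close> would lie below all of \<open>S\<close>
  and be a witness for \<open>upward\<close>. In particular an empty \<open>S\<close> forces an
  empty \<open>B\<close>: the corner of the box.\<close>

lemma not_upward_min:
  assumes "(\<omega>, S, A, B) \<notin> upward" "finite S" "j \<in># B" shows "S \<noteq> {} \<and> Min S \<le> j"
proof (rule ccontr)
  assume *: "\<not> (S \<noteq> {} \<and> Min S \<le> j)"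
  let ?b = "Min (set_mset B)"
  have b: "?b \<in># B" "?b \<le> j" using assms(3) by (auto intro: Min_in)
  have gt: "s > ?b" if s: "s \<in> S" for s
  proof -
    have "j < Min S" using * s by auto
    then show ?thesis using b(2) Min_le[OF assms(2) s] by linarith
  qed
  have "?b \<notin> S \<and> (\<forall>a<?b. a \<notin> S \<and> a \<notin># B)"
  proof (intro conjI allI impI notI)
    show False if "?b \<in> S" using gt[OF that] by simp
    show False if "a < ?b" "a \<in> S" for a using gt[OF that(2)] that(1) by simp
    show False if "a < ?b" "a \<in># B" for a using leD[OF Min_le[OF finite_set_mset that(2)]] that(1) by blast
  qed
  then have "(\<omega>, S, A, B) \<in> upward"
    unfolding upward_def using b(1) by blast
  then show False using assms(1) by blast
qed

text \<open>Inverse of the matching: on a class outside \<open>upward\<close> with nonempty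
  \<open>S\<close> it yields the far facet to which that class is the partner.\<close>

definition push_first :: "'k chr \<times> nat set \<times> nat multiset \<times> nat multiset \<Rightarrow>
    'k chr \<times> nat set \<times> nat multiset \<times> nat multiset" where
  "push_first c = (case c of (\<omega>, S, A, B) \<Rightarrow> (\<omega>, S - {Min S}, A, add_mset (Min S) B))"

lemma class_bd_push_first_nonzero:
  assumes "c \<in> classes (Suc k)" shows "class_bd c (push_first c) \<noteq> 0"
proof -
  obtain \<omega> S A B where c: "c = (\<omega>, S, A, B)" by (cases c)
  have V: "\<omega> \<in> Gdual G" "S \<subseteq> {..<n}" "card S = Suc k" using assms by (auto simp: c classes_def)
  then have fin: "finite S" "S \<noteq> {}" using finite_subset by auto
  then have m: "Min S \<in> S" by simp
  let ?\<chi> = "chr_shift G \<omega> B"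
  have "class_bd c (push_first c) = (\<Sum>j\<in>S. if j = Min S then of_int (eps_up ?\<chi> S j) else 0)"
    unfolding c class_bd_def push_first_def prod.case
    by (rule sum.cong) (auto simp: delta_def)
  also have "\<dots> = of_int (eps_up ?\<chi> S (Min S))" using fin m by simp
  also have "\<dots> \<noteq> 0"
    using eps_up_unit[OF chr_shift_Gdual[OF V(1), of B] V(2) m] by auto
  finally show ?thesis .
qed

text \<open>Acyclicity of the matching: another unmatched-upward class with this facet can only have
  it as a near facet, and then its \<open>B\<close> is larger.\<close>

lemma class_bd_push_first_others:
  assumes c: "c \<in> classes (Suc k) - upward" and c': "c' \<in> classes (Suc k) - upward"
    and ne: "class_bd c' (push_first c) \<noteq> 0"
  shows "c' = c \<or> class_size c < class_size c'"
proof -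
  obtain \<omega> S A B where cc: "c = (\<omega>, S, A, B)" by (cases c)
  obtain \<omega>' S' A' B' where cc': "c' = (\<omega>', S', A', B')" by (cases c')
  have fin: "finite S" "S \<noteq> {}" "finite S'" "S' \<noteq> {}"
    using c c' finite_subset by (auto simp: cc cc' classes_def)
  let ?i = "Min S"
  have i: "?i \<in> S" using fin by simp
  obtain j where j: "j \<in> S'" and "delta (\<omega>', S' - {j}, add_mset j A', B') (push_first c) \<noteq> (0 :: 'k) \<or>
      delta (\<omega>', S' - {j}, A', add_mset j B') (push_first c) \<noteq> (0 :: 'k)"
    using ne unfolding cc' class_bd_def prod.case
    by (metis (no_types, lifting) sum.neutral add_0 mult_zero_right)
  then consider (low) "B' = add_mset ?i B" |
    (up) "\<omega>' = \<omega>" "S' - {j} = S - {?i}" "A' = A" "add_mset j B' = add_mset ?i B"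
    by (auto simp: delta_def push_first_def cc split: if_splits)
  then show ?thesis
  proof cases
    case low
    then show ?thesis by (simp add: class_size_def cc cc')
  next
    case up
    show ?thesis
    proof (cases "j = ?i")
      case True
      then have "S' = S" "B' = B" using up i j by auto
      then show ?thesis using up by (simp add: cc cc')
    next
      \<comment> \<open>If the facet were a far one in a direction other than \<open>Min S\<close>,
        then \<open>Min S\<close> would be a label of \<open>B'\<close> but not a direction of
        \<open>S'\<close>. So \<open>Min S'\<close> is below it, yet it survives the removal of
        \<open>j\<close> and lies in \<open>S\<close>, a contradiction.\<close>
      case False
      then have "j \<in># B" "?i \<in># B'" using up(4) by (metis insert_noteq_member)+
      then have "?i < j" using not_upward_min[of \<omega> S A B j] c fin False by (auto simp: cc)
      have "?i \<notin> S'" using up(2) False by blast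
      moreover have "Min S' \<le> ?i"
        using not_upward_min[of \<omega>' S' A' B' ?i] c' fin \<open>?i \<in># B'\<close> by (auto simp: cc')
      moreover have "Min S' \<in> S'" using fin by simp
      ultimately have "Min S' < ?i" by (metis le_neq_implies_less)
      then have "Min S' \<noteq> j" using \<open>?i < j\<close> by linarith
      then have "Min S' \<in> S' - {j}" using \<open>Min S' \<in> S'\<close> by blast
      then have "Min S' \<in> S" unfolding up(2) by blast
      then have "?i \<le> Min S'" by (rule Min_le[OF fin(1)])
      then show ?thesis using \<open>Min S' < ?i\<close> by simp
    qed
  qed
qed

lemma lin_bd_bd: "y \<in> fsupp (classes (Suc k)) \<Longrightarrow> lin class_bd (lin class_bd y) = (\<lambda>_. 0)"
proof -
  assume y: "y \<in> fsupp (classes (Suc k))"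
  have "lin class_bd (lin class_bd y) = lin (\<lambda>c. lin class_bd (class_bd c)) y"
    by (rule lin_lin[OF y]) (auto intro: fsupp_UNIV class_bd_fsupp)
  also have "\<dots> = lin (\<lambda>_ _. 0) y" by (rule lin_cong[OF y]) (rule class_bd_bd)
  finally show ?thesis by (simp add: lin_def)
qed

lemma class_exact:
  assumes x: "x \<in> fsupp (classes (Suc k))" and z: "lin class_bd x = (\<lambda>_. 0)"
  shows "\<exists>y\<in>fsupp (classes (Suc (Suc k))). x = lin class_bd y"
proof -
  obtain y where y: "y \<in> fsupp (classes (Suc (Suc k)))"
    and xy: "(\<lambda>t. x t - lin class_bd y t) \<in> fsupp (classes (Suc k) - upward)"
    using reduce_mod_image[OF upward_lead x] by blast
  have dy: "lin class_bd y \<in> fsupp UNIV"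
    by (rule fsupp_UNIV, rule lin_fsupp[OF y], rule class_bd_fsupp)
  have "(\<lambda>t. x t - lin class_bd y t) = (\<lambda>_. 0)"
  proof (rule lin_injective_on_leading[OF xy, of class_bd push_first class_size])
    show "lin class_bd (\<lambda>t. x t - lin class_bd y t) = (\<lambda>_. 0)"
      using lin_diff[OF fsupp_UNIV[OF x] dy, of class_bd] by (simp add: z lin_bd_bd[OF y])
    show "class_bd c (push_first c) \<noteq> 0" if "c \<in> classes (Suc k) - upward" for c
      using class_bd_push_first_nonzero that by blast
  qed (rule class_bd_push_first_others)
  then have "x = lin class_bd y" by (simp add: fun_eq_iff)
  then show ?thesis using y by blast
qed

section \<open>The augmentation and exactness in degree zero\<close>

definition class_mu :: "'k chr \<times> nat set \<times> nat multiset \<times> nat multiset \<Rightarrow> 'k chr \<times> nat multiset \<Rightarrow> 'k" where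
  "class_mu c = (case c of (\<omega>, S, A, B) \<Rightarrow> delta (\<omega>, A + B))"

text \<open>Both ends of an edge have the same total monomial, and their signs cancel.\<close>

lemma class_mu_bd:
  assumes "c \<in> classes (Suc 0)" shows "lin class_mu (class_bd c) = (\<lambda>_. 0)"
proof -
  obtain \<omega> S A B where c: "c = (\<omega>, S, A, B)" by (cases c)
  from assms obtain i where S: "S = {i}" and i: "i < n" and \<omega>: "\<omega> \<in> Gdual G"
    by (auto simp: c classes_def card_1_singleton_iff)
  let ?\<chi> = "chr_shift G \<omega> B"
  have "class_bd c = (\<lambda>s. of_int (eps_low ?\<chi> {i} i) * delta (\<omega>, {}, add_mset i A, B) s +
     of_int (eps_up ?\<chi> {i} i) * delta (\<omega>, {}, A, add_mset i B) s)"
    by (simp add: class_bd_def c S)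
  then have "lin class_mu (class_bd c) = (\<lambda>s. of_int (eps_low ?\<chi> {i} i + eps_up ?\<chi> {i} i) *
      delta (\<omega>, add_mset i (A + B)) s)"
    by (simp add: lin_add lin_smul lin_delta fsupp_smul fsupp_delta class_mu_def distrib_right)
  then show ?thesis using eps_edge[OF chr_shift_Gdual[OF \<omega>] i] by simp
qed

lemma lin_mu_bd: "y \<in> fsupp (classes (Suc 0)) \<Longrightarrow> lin class_mu (lin class_bd y) = (\<lambda>_. 0)"
proof -
  assume y: "y \<in> fsupp (classes (Suc 0))"
  have "lin class_mu (lin class_bd y) = lin (\<lambda>c. lin class_mu (class_bd c)) y"
    by (rule lin_lin[OF y]) (auto intro: fsupp_UNIV class_bd_fsupp)
  also have "\<dots> = lin (\<lambda>_ _. 0) y" by (rule lin_cong[OF y]) (rule class_mu_bd)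
  finally show ?thesis by (simp add: lin_def)
qed

lemma class_exact_0:
  assumes x: "x \<in> fsupp (classes 0)" and z: "lin class_mu x = (\<lambda>_. 0)"
  shows "\<exists>y\<in>fsupp (classes (Suc 0)). x = lin class_bd y"
proof -
  obtain y where y: "y \<in> fsupp (classes (Suc 0))"
    and xy: "(\<lambda>t. x t - lin class_bd y t) \<in> fsupp (classes 0 - upward)"
    using reduce_mod_image[OF upward_lead x] by blast
  have dy: "lin class_bd y \<in> fsupp UNIV"
    by (rule fsupp_UNIV, rule lin_fsupp[OF y], rule class_bd_fsupp)
  \<comment> \<open>Only corners remain after the elimination; a corner is determined by
    \<open>\<omega>\<close> and its total monomial, so \<open>class_mu\<close> separates
    them.\<close>
  have W: "\<exists>\<omega> A. c = (\<omega>, {}, A, {#})" if "c \<in> classes 0 - upward" for c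
  proof -
    obtain \<omega> S A B where c: "c = (\<omega>, S, A, B)" by (cases c)
    have "S \<subseteq> {..<n}" "card S = 0" using that by (auto simp: c classes_def)
    then have "S = {}" using finite_subset[of S "{..<n}"] by simp
    moreover have "B = {#}"
      using not_upward_min[of \<omega> S A B] that calculation by (auto simp: c)
    ultimately show ?thesis using c by blast
  qed
  have "(\<lambda>t. x t - lin class_bd y t) = (\<lambda>_. 0)"
  proof (rule lin_injective_on_leading[OF xy, of class_mu "\<lambda>(\<omega>, S, A, B). (\<omega>, A)" class_size])
    show "lin class_mu (\<lambda>t. x t - lin class_bd y t) = (\<lambda>_. 0)"
      using lin_diff[OF fsupp_UNIV[OF x] dy, of class_mu] by (simp add: z lin_mu_bd[OF y])
    show "class_mu c ((\<lambda>(\<omega>, S, A, B). (\<omega>, A)) c) \<noteq> 0" if "c \<in> classes 0 - upward" for c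
      using W[OF that] by (auto simp: class_mu_def delta_def)
    show "c' = c \<or> class_size c < class_size c'"
      if "c \<in> classes 0 - upward" "c' \<in> classes 0 - upward"
        "class_mu c' ((\<lambda>(\<omega>, S, A, B). (\<omega>, A)) c) \<noteq> 0" for c c'
      using W[OF that(1)] W[OF that(2)] that(3) by (auto simp: class_mu_def delta_def split: if_splits)
  qed
  then have "x = lin class_bd y" by (simp add: fun_eq_iff)
  then show ?thesis using y by blast
qed

end

section \<open>The resolution\<close>

context incidence
begin

abbreviation tens_push :: "('k tens \<Rightarrow> 'k) \<Rightarrow> 'k chr \<times> nat set \<times> nat multiset \<times> nat multiset \<Rightarrow> 'k" where
  "tens_push \<equiv> lin (\<lambda>t. delta (tens_class t))"

abbreviation path_push :: "('k path \<Rightarrow> 'k) \<Rightarrow> 'k chr \<times> nat multiset \<Rightarrow> 'k" where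
  "path_push \<equiv> lin (\<lambda>p. delta (path_class p))"

lemma tens_push_fsupp: "x \<in> Pmod n G k \<Longrightarrow> tens_push x \<in> fsupp (classes k)"
  unfolding Pmod_eq_fsupp by (erule lin_fsupp) (auto intro!: fsupp_delta tens_class_classes)

lemma dmap_radical:
  assumes "x \<in> Pmod n G (Suc k)"
  shows "dmap n G \<epsilon> x \<in> fsupp {(p, \<eta>, q) \<in> Tk n G k. snd p \<noteq> [] \<or> snd q \<noteq> []}"
  unfolding dmap_eq_lin by (rule lin_fsupp[OF assms[unfolded Pmod_eq_fsupp]]) (rule dbasis_in(1))

lemma dmap_Pmod: "x \<in> Pmod n G (Suc k) \<Longrightarrow> dmap n G \<epsilon> x \<in> Pmod n G k"
  unfolding Pmod_eq_fsupp[of n G k] by (rule fsupp_mono[OF dmap_radical]) auto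

text \<open>With \<open>path_push_mu\<close>, this says that passing to classes is a chain map onto
  the combinatorial complex.\<close>

lemma tens_push_dmap:
  assumes "x \<in> Pmod n G (Suc k)" shows "tens_push (dmap n G \<epsilon> x) = lin class_bd (tens_push x)"
proof -
  have x: "x \<in> fsupp (Tk n G (Suc k))" using assms by (simp add: Pmod_eq_fsupp)
  have "tens_push (dmap n G \<epsilon> x) = lin (\<lambda>t. tens_push (dbasis n G \<epsilon> t)) x"
    unfolding dmap_eq_lin by (rule lin_lin[OF x]) (rule fsupp_UNIV[OF dbasis_in(1)])
  also have "\<dots> = lin class_bd (tens_push x)"
    by (rule lin_class_factor[OF x]) (rule dbasis_in(2))
  finally show ?thesis .
qed

lemma mu_term:
  assumes "(p, \<eta>, q) \<in> Tk n G 0"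
  shows "kQmul G (delta p) (delta q) = delta (pcomp p q)" "valid_path n G (pcomp p q)"
    "delta (path_class (pcomp p q)) = class_mu (tens_class (p, \<eta>, q))"
proof -
  from assms obtain \<chi> S a \<omega> b where t: "p = (chr_shift G \<chi> (mset_set S), a)" "\<eta> = cell_of \<chi> S" "q = (\<omega>, b)"
    and v: "\<omega> \<in> Gdual G" "S \<subseteq> {..<n}" "card S = 0" "set a \<subseteq> {..<n}" "set b \<subseteq> {..<n}"
    and \<chi>: "\<chi> = chr_shift G \<omega> (mset b)"
    unfolding Tk_iff by blast
  have "S = {}" using v(2,3) finite_subset[of S "{..<n}"] by simp
  then show "kQmul G (delta p) (delta q) = delta (pcomp p q)"
    by (simp add: kQmul_delta_delta t \<chi> path_head_eq)
  show "valid_path n G (pcomp p q)" using v by (simp add: t pcomp_def valid_path_def)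
  show "delta (path_class (pcomp p q)) = class_mu (tens_class (p, \<eta>, q))"
    by (simp add: t pcomp_def path_class_def class_mu_def tens_class_def add.commute)
qed

lemma mu_kQ: "x \<in> Pmod n G 0 \<Longrightarrow> mu G x \<in> kQ n G"
  unfolding mu_eq_lin kQ_eq_fsupp Pmod_eq_fsupp
  by (erule lin_fsupp) (auto simp: mu_term intro!: fsupp_delta)

lemma path_push_mu:
  assumes "x \<in> Pmod n G 0" shows "path_push (mu G x) = lin class_mu (tens_push x)"
proof -
  have x: "x \<in> fsupp (Tk n G 0)" using assms by (simp add: Pmod_eq_fsupp)
  have "path_push (mu G x) = lin (\<lambda>t. path_push (case t of (p, \<eta>, q) \<Rightarrow> kQmul G (delta p) (delta q))) x"
    unfolding mu_eq_lin by (rule lin_lin[OF x]) (auto simp: mu_term intro!: fsupp_delta)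
  also have "\<dots> = lin class_mu (tens_push x)"
    by (rule lin_class_factor[OF x]) (auto simp: mu_term lin_delta)
  finally show ?thesis .
qed

lemma tens_push_lift:
  assumes Y: "Y \<in> fsupp (classes k)"
  shows "\<exists>y\<in>Pmod n G k. tens_push y = Y"
proof
  let ?y = "lin (\<lambda>c. delta (class_rep c)) Y"
  show "?y \<in> Pmod n G k"
    unfolding Pmod_eq_fsupp by (rule lin_fsupp[OF Y]) (rule fsupp_delta[OF class_rep_Tk])
  have "tens_push ?y = lin delta Y"
    by (subst lin_lin[OF Y]) (auto simp: lin_delta tens_class_rep fsupp_delta intro!: lin_cong[OF Y])
  then show "tens_push ?y = Y" by (simp add: lin_delta_id[OF Y])
qed

lemma diff_dmap_Nsub:
  assumes x: "x \<in> Pmod n G k" and y: "y \<in> Pmod n G (Suc k)" and eq: "tens_push x = lin class_bd (tens_push y)"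
  shows "(\<lambda>t. x t - dmap n G \<epsilon> y t) \<in> Nsub n G k"
proof -
  note dy = dmap_Pmod[OF y]
  have "(\<lambda>t. x t - dmap n G \<epsilon> y t) \<in> Pmod n G k"
    using x dy unfolding Pmod_eq_fsupp by (rule fsupp_diff)
  moreover have "tens_push (\<lambda>t. x t - dmap n G \<epsilon> y t) = (\<lambda>_. 0)"
    using x dy unfolding Pmod_eq_fsupp
    by (subst lin_diff) (auto intro: fsupp_UNIV simp: tens_push_dmap[OF y] eq)
  ultimately show ?thesis by (simp add: Nsub_iff)
qed

lemma mu_surj:
  assumes "a \<in> kQ n G" shows "\<exists>x\<in>Pmod n G 0. mu G x = a"
proof
  have a: "a \<in> fsupp {p. valid_path n G p}" using assms by (simp add: kQ_eq_fsupp)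
  \<comment> \<open>The whole path goes into the right factor; the left factor is the trivial path
    at its head.\<close>
  let ?f = "\<lambda>q. ((path_head G q, []), cell_of (path_head G q) {}, q)"
  have T: "?f q \<in> Tk n G 0" if "valid_path n G q" for q
    using that by (cases q) (auto intro!: TkI simp: path_head_eq valid_path_def)
  show "lin (\<lambda>q. delta (?f q)) a \<in> Pmod n G 0"
    unfolding Pmod_eq_fsupp by (rule lin_fsupp[OF a]) (use T in \<open>auto intro!: fsupp_delta\<close>)
  have "mu G (lin (\<lambda>q. delta (?f q)) a) = lin delta a"
    unfolding mu_eq_lin
    by (subst lin_lin[OF a])
      (auto simp: lin_delta fsupp_delta kQmul_delta_delta pcomp_def intro!: lin_cong[OF a])
  then show "mu G (lin (\<lambda>q. delta (?f q)) a) = a" by (simp add: lin_delta_id[OF a])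
qed

lemma resolution: "min_proj_bimod_resolution n G \<epsilon>"
  unfolding min_proj_bimod_resolution_def
proof (intro conjI allI ballI impI)
  fix k x assume "1 \<le> k" and x: "x \<in> Pmod n G k"
  then obtain l where k: "k = Suc l" by (cases k) auto
  show "dmap n G \<epsilon> x \<in> Pmod n G (k - 1)" using dmap_Pmod x by (simp add: k)
  show "\<exists>y\<in>Pmod n G (k - 1). (\<forall>p \<eta> q. y (p, \<eta>, q) \<noteq> 0 \<longrightarrow> snd p \<noteq> [] \<or> snd q \<noteq> []) \<and>
      (\<lambda>t. dmap n G \<epsilon> x t - y t) \<in> Nsub n G (k - 1)"
  \<comment> \<open>The image itself serves as \<open>y\<close>: by \<open>dmap_radical\<close> its
    terms already contain an arrow, so the difference is zero.\<close>
  proof (intro bexI conjI allI impI)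
    show "dmap n G \<epsilon> x \<in> Pmod n G (k - 1)" using dmap_Pmod x by (simp add: k)
    show "snd p \<noteq> [] \<or> snd q \<noteq> []" if "dmap n G \<epsilon> x (p, \<eta>, q) \<noteq> 0" for p \<eta> q
      using fsupp_mem[OF dmap_radical[OF x[unfolded k]] that] by auto
  qed (simp add: Nsub.zero)
next
  fix k x assume "1 \<le> k" and N: "x \<in> Nsub n G k"
  then obtain l where k: "k = Suc l" by (cases k) auto
  from N have "x \<in> Pmod n G (Suc l)" "tens_push x = (\<lambda>_. 0)" by (simp_all add: Nsub_iff k)
  then show "dmap n G \<epsilon> x \<in> Nsub n G (k - 1)"
    by (simp add: k Nsub_iff dmap_Pmod tens_push_dmap lin_zero)
next
  fix x assume "x \<in> Pmod n G 0" then show "mu G x \<in> kQ n G" by (rule mu_kQ)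
next
  fix x assume "x \<in> Nsub n G 0"
  then show "mu G x \<in> Jideal n G"
    by (simp add: Nsub_iff Jideal_iff mu_kQ path_push_mu lin_zero)
next
  fix k x assume "2 \<le> k" and x: "x \<in> Pmod n G k"
  then obtain l where k: "k = Suc (Suc l)" by (cases k; cases "k - 1") auto
  note x = x[unfolded k]
  show "dmap n G \<epsilon> (dmap n G \<epsilon> x) \<in> Nsub n G (k - 2)"
    using dmap_Pmod[OF dmap_Pmod[OF x]]
    by (simp add: k Nsub_iff tens_push_dmap[OF dmap_Pmod[OF x]] tens_push_dmap[OF x]
        lin_bd_bd[OF tens_push_fsupp[OF x]])
next
  fix x assume "x \<in> Pmod n G 1"
  then have x: "x \<in> Pmod n G (Suc 0)" by simp
  show "mu G (dmap n G \<epsilon> x) \<in> Jideal n G"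
    using mu_kQ[OF dmap_Pmod[OF x]]
    by (simp add: Jideal_iff path_push_mu[OF dmap_Pmod[OF x]] tens_push_dmap[OF x]
        lin_mu_bd[OF tens_push_fsupp[OF x]])
next
  fix a assume "a \<in> kQ n G"
  then obtain x where "x \<in> Pmod n G 0" "mu G x = a" using mu_surj by blast
  then show "\<exists>x\<in>Pmod n G 0. (\<lambda>r. mu G x r - a r) \<in> Jideal n G"
    by (intro bexI[of _ x]) (simp_all add: Jideal.zero)
next
  fix x assume x: "x \<in> Pmod n G 0" and "mu G x \<in> Jideal n G"
  then have "lin class_mu (tens_push x) = (\<lambda>_. 0)" by (simp add: Jideal_iff path_push_mu)
  then obtain Y where "Y \<in> fsupp (classes (Suc 0))" "tens_push x = lin class_bd Y"
    using class_exact_0[OF tens_push_fsupp[OF x]] by blast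
  then obtain y where y: "y \<in> Pmod n G (Suc 0)" "tens_push x = lin class_bd (tens_push y)"
    using tens_push_lift by metis
  then show "\<exists>y\<in>Pmod n G 1. (\<lambda>t. x t - dmap n G \<epsilon> y t) \<in> Nsub n G 0"
    using diff_dmap_Nsub[OF x y] by auto
next
  fix k x assume "1 \<le> k" and x: "x \<in> Pmod n G k" and N: "dmap n G \<epsilon> x \<in> Nsub n G (k - 1)"
  then obtain l where k: "k = Suc l" by (cases k) auto
  have "lin class_bd (tens_push x) = (\<lambda>_. 0)"
    using N tens_push_dmap[OF x[unfolded k]] by (simp add: Nsub_iff)
  then obtain Y where "Y \<in> fsupp (classes (Suc k))" "tens_push x = lin class_bd Y"
    using class_exact[OF tens_push_fsupp] x unfolding k by blast
  then obtain y where y: "y \<in> Pmod n G (Suc k)" "tens_push x = lin class_bd (tens_push y)"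
    using tens_push_lift by metis
  then show "\<exists>y\<in>Pmod n G (k + 1). (\<lambda>t. x t - dmap n G \<epsilon> y t) \<in> Nsub n G k"
    using diff_dmap_Nsub[OF x y] by auto
qed

end

theorem theorem4p10:
  fixes n :: nat and G :: "('k::alg_closed_field) diag set"
    and \<epsilon> :: "cell \<Rightarrow> cell \<Rightarrow> int"
  assumes "n \<ge> 1"
    and "diag_SL_subgroup n G"
    and "\<not> CHAR('k) dvd card G"
    and "incidence_fun n G \<epsilon>"
  shows "min_proj_bimod_resolution n G \<epsilon>"
proof -
  interpret incidence n G \<epsilon>
    by unfold_locales (use assms in auto)
  show ?thesis by (rule resolution)
qed

end
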